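(* Let $n\ge2$. Then \[\mathrm{span}\{V_{k,n}^+,V_{k,n}^-:k\ge1\}=\mathrm{span}\{V_{k,n}^+,V_{k,n}^-:1\le k<n\}=\mathcal{W}_n^{\pm}\] is an algebra under the internal product, and the following are five commutative subalgebras of $\mathcal{W}_n^\pm$: \begin{align*} \mathrm{span}\{V_{k,n}:k\ge1\}&=\mathrm{span}\{V_{k,n}:1\le k<n\}=\mathcal{W}_n,\\ \mathrm{span}\{V^+_{k,n}:k\ge1\}&=\mathrm{span}\{V^+_{k,n}:1\le k\le n\}=\mathcal{W}^\circ_n,\\ \mathrm{span}\{V^-_{2k,n}:k\ge1\}&=\mathrm{span}\{V^-_{2k,n}:1\le 2k\le n+1\}=\mathcal{P}_n,\\ \mathrm{span}\{V^+_{2k+1,n}:k\ge0\}&=\mathrm{span}\{V^+_{2k+1,n}:1\le 2k+1\le n+1\}=\mathcal{P}^\circ_n,\\ \mathrm{span}\{V^+_{2k+1,n},V^-_{2k+1,n},V_{2k,n}:k\ge0\}&=\mathrm{span}\{V^+_{2k+1,n},V^-_{2k+1,n},V_{2l,n}:1\le 2k+1<n,\ 1\le 2l<n\}=\mathcal{C}_n. \end{align*} Furthermore, $\mathcal{P}^\circ_n$ is central in $\mathcal{W}_n^\pm$.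
   Context: Compositions, descent sets: a composition $I=(i_1,\dots,i_r)$ of $n$ has descent set $\{i_1,\dots,i_1+\dots+i_{r-1}\}$. $\mathbf{Sym}=\bigoplus_n\mathbf{Sym}_n$ is the algebra of noncommutative symmetric functions over $\mathbb{Q}$ with ribbon basis $R_I$; $\mathbf{Sym}_n$ is identified with the descent algebra $\mathcal{D}_n\subseteq\mathbb{Q}[\mathfrak{S}_n]$ via $R_I\mapsto\sum\{\sigma:\mathrm{Des}(\sigma)=\text{descent set of }I\}$, $\mathrm{Des}(\sigma)=\{i:\sigma(i)>\sigma(i+1)\}$. The internal product is the product of $\mathbb{Q}[\mathfrak{S}_n]$ (with $(\alpha\beta)(i)=\alpha(\beta(i))$) in each degree, zero between different degrees. The external product is $R_{(i_1,\dots,i_r)}\star R_{(j_1,\dots,j_s)}=R_{(i_1,\dots,i_r,j_1,\dots,j_s)}+R_{(i_1,\dots,i_{r-1},i_r+j_1,j_2,\dots,j_s)}$, $R_\emptyset=1$; both products extend degreewise to the completion $\widehat{\mathbf{Sym}}$. Define $V_1^+=\sum_{i\ge0}R_{(i)}$, $V_1^-=\sum_{i\ge0}R_{(1^i)}$, $V_{2k}^+=(V_1^+\star V_1^-)^{\star k}$, $V_{2k}^-=(V_1^-\star V_1^+)^{\star k}$, $V_{2k+1}^+=V_1^+\star(V_1^-\star V_1^+)^{\star k}$, $V_{2k+1}^-=V_1^-\star(V_1^+\star V_1^-)^{\star k}$, $V_k=V_k^++V_k^-$; $V_{k,n}^\pm,V_{k,n}$ denote degree-$n$ components. For $\sigma\in\mathfrak{S}_n$: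 an alternating run is a maximal monotone sequence of consecutive entries of $\sigma(1),\dots,\sigma(n)$, $\mathrm{run}(\sigma)$ their number; a left run is defined the same way for $\sigma(0),\sigma(1),\dots,\sigma(n)$ with $\sigma(0)=0$, $\mathrm{run}^\circ(\sigma)$ their number. $W_{k,n}^+$ (resp. $W_{k,n}^-$) is the sum of $\sigma\in\mathfrak{S}_n$ with $\mathrm{run}(\sigma)=k$ and first run ascending (resp. descending), $W_{k,n}=W_{k,n}^++W_{k,n}^-$, $W^\circ_{k,n}$ the sum of $\sigma$ with $\mathrm{run}^\circ(\sigma)=k$. Then $\mathcal{W}_n^\pm=\mathrm{span}\{W_{k,n}^\pm:1\le k\le n-1\}$, $\mathcal{W}_n=\mathrm{span}\{W_{k,n}:1\le k\le n-1\}$, $\mathcal{W}_n^\circ=\mathrm{span}\{W^\circ_{k,n}:1\le k\le n\}$, $\mathcal{C}_n=\mathrm{span}\{W_{2k,n}\}\oplus\mathrm{span}\{W^+_{2k-1,n},W^-_{2k-1,n}\}$ (over the nonzero ones). A peak of $\sigma$ is $i$, $2\le i\le n-1$, with $\sigma(i-1)<\sigma(i)>\sigma(i+1)$; a left peak is $i$, $1\le i\le n-1$, with the same condition and $\sigma(0)=0$; $\mathcal{P}_n$ (resp. $\mathcal{P}_n^\circ$) is spanned by the sums of permutations with a given number of peaks (resp. left peaks). *)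

theory Defs
  imports Complex_Main "HOL-Combinatorics.Permutations" "HOL-Library.Function_Algebras"
begin

text \<open>
  Formal \<open>\<rat>\<close>-linear combinations are represented by their coefficient functions, with the
  pointwise vector space structure. The pointwise product of \<^theory>\<open>HOL-Library.Function_Algebras\<close>
  plays no role; the relevant products are defined explicitly below.
\<close>

definition qscale :: "rat \<Rightarrow> ('a \<Rightarrow> rat) \<Rightarrow> 'a \<Rightarrow> rat"
  where "qscale c f = (\<lambda>x. c * f x)"

global_interpretation QV: vector_space "qscale :: rat \<Rightarrow> ('a \<Rightarrow> rat) \<Rightarrow> 'a \<Rightarrow> rat"
  by unfold_locales (simp_all add: qscale_def fun_eq_iff algebra_simps)

subsection \<open>The completed algebra of noncommutative symmetric functions\<close>

definition compositions :: "nat \<Rightarrow> nat list set"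
  where "compositions n = {I. (\<forall>i\<in>set I. 1 \<le> i) \<and> sum_list I = n}"

lemma finite_compositions: "finite (compositions n)"
proof -
  have "length I \<le> sum_list I" if "\<forall>i\<in>set I. 1 \<le> i" for I :: "nat list"
    using that by (induction I) auto
  moreover have "set I \<subseteq> {..sum_list I}" for I :: "nat list"
    using member_le_sum_list by blast
  ultimately have "compositions n \<subseteq> {I. set I \<subseteq> {..n} \<and> length I \<le> n}"
    by (auto simp: compositions_def)
  then show ?thesis
    by (rule finite_subset) (rule finite_lists_length_le, simp)
qed

definition descent_set :: "nat list \<Rightarrow> nat set"
  where "descent_set I = {sum_list (take k I) | k. 1 \<le> k \<and> k < length I}"

text \<open>
  \<open>F :: nsym\<close> stands for the (possibly infinite) combination \<open>\<Sum>I. F I \<cdot> R\<^sub>I\<close> over all compositions \<open>I\<close>.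
\<close>

type_synonym nsym = "nat list \<Rightarrow> rat"

definition ribbon :: "nat list \<Rightarrow> nsym"
  where "ribbon I = (\<lambda>K. of_bool (K = I))"

definition ribbon_mult :: "nat list \<Rightarrow> nat list \<Rightarrow> nsym"
  where "ribbon_mult I J =
    (if I = [] then ribbon J else if J = [] then ribbon I
     else ribbon (I @ J) + ribbon (butlast I @ (last I + hd J) # tl J))"

text \<open>
  Only pairs \<open>(I, J)\<close> with \<open>|I| + |J| = |K|\<close> contribute to the coefficient of \<open>R\<^sub>K\<close>, so the sum is finite.
\<close>

definition ext_prod :: "nsym \<Rightarrow> nsym \<Rightarrow> nsym"  (infixl "\<star>" 70)
  where "F \<star> G = (\<lambda>K. \<Sum>d\<le>sum_list K. \<Sum>I\<in>compositions d. \<Sum>J\<in>compositions (sum_list K - d).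
    F I * G J * ribbon_mult I J K)"

primrec ext_power :: "nsym \<Rightarrow> nat \<Rightarrow> nsym"
  where
    "ext_power F 0 = ribbon []"
  | "ext_power F (Suc k) = F \<star> ext_power F k"

text \<open>The terms for \<open>i = 0\<close> of both series are \<open>R\<^sub>\<emptyset> = 1\<close>.\<close>

definition V1_plus :: nsym
  where "V1_plus = (\<lambda>I. of_bool (I = [] \<or> (\<exists>i\<ge>1. I = [i])))"

definition V1_minus :: nsym
  where "V1_minus = (\<lambda>I. of_bool (\<exists>i. I = replicate i 1))"

definition V_plus :: "nat \<Rightarrow> nsym"
  where "V_plus k =
    (if even k then ext_power (V1_plus \<star> V1_minus) (k div 2)
     else V1_plus \<star> ext_power (V1_minus \<star> V1_plus) (k div 2))"

definition V_minus :: "nat \<Rightarrow> nsym"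
  where "V_minus k =
    (if even k then ext_power (V1_minus \<star> V1_plus) (k div 2)
     else V1_minus \<star> ext_power (V1_plus \<star> V1_minus) (k div 2))"

subsection \<open>The group algebra of the symmetric group\<close>

definition group_algebra :: "nat \<Rightarrow> ((nat \<Rightarrow> nat) \<Rightarrow> rat) set"
  where "group_algebra n = {f. \<forall>\<sigma>. f \<sigma> \<noteq> 0 \<longrightarrow> \<sigma> permutes {1..n}}"

definition int_prod ::
    "nat \<Rightarrow> ((nat \<Rightarrow> nat) \<Rightarrow> rat) \<Rightarrow> ((nat \<Rightarrow> nat) \<Rightarrow> rat) \<Rightarrow> (nat \<Rightarrow> nat) \<Rightarrow> rat"
  where "int_prod n f g = (\<lambda>\<tau>. \<Sum>\<alpha> | \<alpha> permutes {1..n}. \<Sum>\<beta> | \<beta> permutes {1..n}.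
    f \<alpha> * g \<beta> * of_bool (\<tau> = \<alpha> \<circ> \<beta>))"

definition perm_sum :: "nat \<Rightarrow> ((nat \<Rightarrow> nat) \<Rightarrow> bool) \<Rightarrow> (nat \<Rightarrow> nat) \<Rightarrow> rat"
  where "perm_sum n P = (\<lambda>\<sigma>. of_bool (\<sigma> permutes {1..n} \<and> P \<sigma>))"

text \<open>
  Subalgebras are not required to contain the identity permutation: for example, the span of the
  sums of permutations with a given number of alternating runs does not contain it.
\<close>

definition is_subalgebra :: "nat \<Rightarrow> ((nat \<Rightarrow> nat) \<Rightarrow> rat) set \<Rightarrow> bool"
  where "is_subalgebra n A \<longleftrightarrow>
    A \<subseteq> group_algebra n \<and> QV.subspace A \<and> (\<forall>x\<in>A. \<forall>y\<in>A. int_prod n x y \<in> A)"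

definition comm_subalgebra_of ::
    "nat \<Rightarrow> ((nat \<Rightarrow> nat) \<Rightarrow> rat) set \<Rightarrow> ((nat \<Rightarrow> nat) \<Rightarrow> rat) set \<Rightarrow> bool"
  where "comm_subalgebra_of n A B \<longleftrightarrow>
    is_subalgebra n A \<and> A \<subseteq> B \<and> (\<forall>x\<in>A. \<forall>y\<in>A. int_prod n x y = int_prod n y x)"

definition Des :: "nat \<Rightarrow> (nat \<Rightarrow> nat) \<Rightarrow> nat set"
  where "Des n \<sigma> = {i. 1 \<le> i \<and> i < n \<and> \<sigma> i > \<sigma> (i + 1)}"

text \<open>
  The degree-\<open>n\<close> component of a series, as an element of the descent algebra.
\<close>

definition component :: "nat \<Rightarrow> nsym \<Rightarrow> (nat \<Rightarrow> nat) \<Rightarrow> rat"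
  where "component n F =
    (\<Sum>I\<in>compositions n. qscale (F I) (perm_sum n (\<lambda>\<sigma>. Des n \<sigma> = descent_set I)))"

definition Vp :: "nat \<Rightarrow> nat \<Rightarrow> (nat \<Rightarrow> nat) \<Rightarrow> rat"
  where "Vp k n = component n (V_plus k)"

definition Vm :: "nat \<Rightarrow> nat \<Rightarrow> (nat \<Rightarrow> nat) \<Rightarrow> rat"
  where "Vm k n = component n (V_minus k)"

definition V :: "nat \<Rightarrow> nat \<Rightarrow> (nat \<Rightarrow> nat) \<Rightarrow> rat"
  where "V k n = component n (V_plus k + V_minus k)"

subsection \<open>Runs and peaks\<close>

definition monotone_between :: "(nat \<Rightarrow> nat) \<Rightarrow> nat \<Rightarrow> nat \<Rightarrow> bool"
  where "monotone_between \<sigma> i j \<longleftrightarrow> strict_mono_on {i..j} \<sigma> \<or> strict_antimono_on {i..j} \<sigma>"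

text \<open>
  A run \<open>\<sigma>(i), \<dots>, \<sigma>(j)\<close> of the word \<open>\<sigma>(a), \<dots>, \<sigma>(b)\<close> is given by its pair \<open>(i, j)\<close> of end positions.
\<close>

definition runs :: "nat \<Rightarrow> nat \<Rightarrow> (nat \<Rightarrow> nat) \<Rightarrow> (nat \<times> nat) set"
  where "runs a b \<sigma> = {(i, j). a \<le> i \<and> i \<le> j \<and> j \<le> b \<and> monotone_between \<sigma> i j \<and>
    (\<forall>i' j'. a \<le> i' \<and> i' \<le> i \<and> j \<le> j' \<and> j' \<le> b \<and> monotone_between \<sigma> i' j' \<longrightarrow> i' = i \<and> j' = j)}"

definition run :: "nat \<Rightarrow> (nat \<Rightarrow> nat) \<Rightarrow> nat"
  where "run n \<sigma> = card (runs 1 n \<sigma>)"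

text \<open>
  A function \<open>\<sigma>\<close> with \<open>\<sigma> permutes {1..n}\<close> fixes everything outside \<open>{1..n}\<close>, so the convention
  \<open>\<sigma>(0) = 0\<close> for left runs and left peaks holds automatically.
\<close>

definition left_run :: "nat \<Rightarrow> (nat \<Rightarrow> nat) \<Rightarrow> nat"
  where "left_run n \<sigma> = card (runs 0 n \<sigma>)"

definition first_run_ascending :: "nat \<Rightarrow> (nat \<Rightarrow> nat) \<Rightarrow> bool"
  where "first_run_ascending n \<sigma> \<longleftrightarrow> (\<exists>j. (1, j) \<in> runs 1 n \<sigma> \<and> strict_mono_on {1..j} \<sigma>)"

definition first_run_descending :: "nat \<Rightarrow> (nat \<Rightarrow> nat) \<Rightarrow> bool"
  where "first_run_descending n \<sigma> \<longleftrightarrow> (\<exists>j. (1, j) \<in> runs 1 n \<sigma> \<and> strict_antimono_on {1..j} \<sigma>)"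

definition peaks :: "nat \<Rightarrow> (nat \<Rightarrow> nat) \<Rightarrow> nat set"
  where "peaks n \<sigma> = {i. 2 \<le> i \<and> i \<le> n - 1 \<and> \<sigma> (i - 1) < \<sigma> i \<and> \<sigma> i > \<sigma> (i + 1)}"

definition left_peaks :: "nat \<Rightarrow> (nat \<Rightarrow> nat) \<Rightarrow> nat set"
  where "left_peaks n \<sigma> = {i. 1 \<le> i \<and> i \<le> n - 1 \<and> \<sigma> (i - 1) < \<sigma> i \<and> \<sigma> i > \<sigma> (i + 1)}"

definition Wp :: "nat \<Rightarrow> nat \<Rightarrow> (nat \<Rightarrow> nat) \<Rightarrow> rat"
  where "Wp k n = perm_sum n (\<lambda>\<sigma>. run n \<sigma> = k \<and> first_run_ascending n \<sigma>)"

definition Wm :: "nat \<Rightarrow> nat \<Rightarrow> (nat \<Rightarrow> nat) \<Rightarrow> rat"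
  where "Wm k n = perm_sum n (\<lambda>\<sigma>. run n \<sigma> = k \<and> first_run_descending n \<sigma>)"

definition W :: "nat \<Rightarrow> nat \<Rightarrow> (nat \<Rightarrow> nat) \<Rightarrow> rat"
  where "W k n = Wp k n + Wm k n"

definition W_left :: "nat \<Rightarrow> nat \<Rightarrow> (nat \<Rightarrow> nat) \<Rightarrow> rat"
  where "W_left k n = perm_sum n (\<lambda>\<sigma>. left_run n \<sigma> = k)"

subsection \<open>The subspaces\<close>

definition Wpm_space :: "nat \<Rightarrow> ((nat \<Rightarrow> nat) \<Rightarrow> rat) set"
  where "Wpm_space n =
    QV.span ({Wp k n | k. 1 \<le> k \<and> k \<le> n - 1} \<union> {Wm k n | k. 1 \<le> k \<and> k \<le> n - 1})"

definition W_space :: "nat \<Rightarrow> ((nat \<Rightarrow> nat) \<Rightarrow> rat) set"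
  where "W_space n = QV.span {W k n | k. 1 \<le> k \<and> k \<le> n - 1}"

definition W_left_space :: "nat \<Rightarrow> ((nat \<Rightarrow> nat) \<Rightarrow> rat) set"
  where "W_left_space n = QV.span {W_left k n | k. 1 \<le> k \<and> k \<le> n}"

definition C_even_space :: "nat \<Rightarrow> ((nat \<Rightarrow> nat) \<Rightarrow> rat) set"
  where "C_even_space n = QV.span ({W (2 * k) n | k. 1 \<le> k} - {0})"

definition C_odd_space :: "nat \<Rightarrow> ((nat \<Rightarrow> nat) \<Rightarrow> rat) set"
  where "C_odd_space n =
    QV.span ({Wp (2 * k - 1) n | k. 1 \<le> k} \<union> {Wm (2 * k - 1) n | k. 1 \<le> k} - {0})"

text \<open>The sum is direct, by the lemma \<open>C_space_direct\<close> below.\<close>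

definition C_space :: "nat \<Rightarrow> ((nat \<Rightarrow> nat) \<Rightarrow> rat) set"
  where "C_space n = {x + y | x y. x \<in> C_even_space n \<and> y \<in> C_odd_space n}"

lemma C_space_direct: "C_even_space n \<inter> C_odd_space n = {0}"
proof -
  have sub: "QV.subspace {x :: (nat \<Rightarrow> nat) \<Rightarrow> rat. \<forall>\<sigma>. P \<sigma> \<longrightarrow> x \<sigma> = 0}" for P
    by (rule QV.subspaceI) (simp_all add: qscale_def)
  have "C_even_space n \<subseteq> {x. \<forall>\<sigma>. odd (run n \<sigma>) \<longrightarrow> x \<sigma> = 0}"
    unfolding C_even_space_def
    by (rule QV.span_minimal[OF _ sub]) (auto simp: W_def Wp_def Wm_def perm_sum_def)
  moreover have "C_odd_space n \<subseteq> {x. \<forall>\<sigma>. even (run n \<sigma>) \<longrightarrow> x \<sigma> = 0}"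
    unfolding C_odd_space_def
    by (rule QV.span_minimal[OF _ sub]) (auto simp: Wp_def Wm_def perm_sum_def)
  ultimately have "x = 0" if "x \<in> C_even_space n" "x \<in> C_odd_space n" for x
    using that by (fastforce simp: fun_eq_iff)
  moreover have "0 \<in> C_even_space n" "0 \<in> C_odd_space n"
    by (simp_all add: C_even_space_def C_odd_space_def QV.span_zero)
  ultimately show ?thesis
    by blast
qed

definition P_space :: "nat \<Rightarrow> ((nat \<Rightarrow> nat) \<Rightarrow> rat) set"
  where "P_space n = QV.span {perm_sum n (\<lambda>\<sigma>. card (peaks n \<sigma>) = k) | k. True}"

definition P_left_space :: "nat \<Rightarrow> ((nat \<Rightarrow> nat) \<Rightarrow> rat) set"
  where "P_left_space n = QV.span {perm_sum n (\<lambda>\<sigma>. card (left_peaks n \<sigma>) = k) | k. True}"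

end

theory Submission
  imports Defs "HOL-Computational_Algebra.Formal_Power_Series"
begin

text \<open>
  For a word \<open>A\<close> in the signs \<open>+\<close>, \<open>-\<close> let \<open>V\<^sub>A\<close> be the external product of the corresponding series
  \<open>V\<^sub>1\<^sup>\<plusminus>\<close>. Its degree \<open>n\<close> component is the sum, over all labellings of \<open>{1..n}\<close> by the positions of \<open>A\<close>, of the
  permutation that sorts the values by label, equal labels being sorted increasingly or decreasingly
  according to the sign. Sorting twice amounts to sorting once by pairs of labels, so \<open>V\<^sub>A V\<^sub>B\<close> is \<open>V\<^sub>C\<close>, where
  \<open>C\<close> arises from \<open>B\<close> by replacing each \<open>+\<close> by \<open>A\<close> and each \<open>-\<close> by the reversed negative of \<open>A\<close>. For alternating
  sign words this gives \<open>V\<^sub>k\<^sup>s V\<^sub>l\<^sup>t = V\<^sub>k\<^sub>l\<^sup>s\<close> for even \<open>k\<close> and \<open>V\<^sub>k\<^sub>l\<^bsup>st\<^esup>\<close> for odd \<open>k\<close>, which yields all the closure,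
  commutativity and centrality claims.

  The spans are computed from the generating function
  \<open>\<Sum>\<^sub>k V\<^sub>k\<^sup>s(\<sigma>) X\<^sup>k = X (1 + X)\<^sup>2 (1 + X\<^sup>2)\<^bsup>n-1-c\<^esup> (2 X)\<^sup>c / (1 - X\<^sup>2)\<^bsup>n+1\<^esup>\<close>,
  where \<open>c\<close> is the number of sign changes in \<open>s\<close> followed by the ascents and descents of \<open>\<sigma>\<close>. It shows
  that the change of basis is triangular. The series for \<open>c\<close> and \<open>c + 1\<close> differ only in degrees
  congruent to \<open>c + 1\<close> modulo 2, which accounts for the coarser statistics in the peak algebras and in \<open>C\<^sub>n\<close>.
\<close>

subsection \<open>Series as functions on words\<close>

text \<open>Equal neighbours count as a descent. This keeps the product formula valid for arbitrary
  words; distinct letters are required only where permutations or sorting enter.\<close>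

fun descent_comp :: "nat list \<Rightarrow> nat list"
  where
    "descent_comp [] = []"
  | "descent_comp [a] = [1]"
  | "descent_comp (a # b # w) =
      (if a < b then Suc (hd (descent_comp (b # w))) # tl (descent_comp (b # w))
       else 1 # descent_comp (b # w))"

lemma descent_comp_eq_Nil_iff [simp]: "descent_comp w = [] \<longleftrightarrow> w = []"
  by (induction w rule: descent_comp.induct) auto

lemma descent_comp_in_compositions: "descent_comp w \<in> compositions (length w)"
proof (induction w rule: descent_comp.induct)
  case (3 a b w)
  then obtain h t where "descent_comp (b # w) = h # t"
    using descent_comp_eq_Nil_iff by (metis list.discI list.exhaust)
  with 3 show ?case by (auto simp: compositions_def)
qed (auto simp: compositions_def)

text \<open>The two outcomes are the two terms of the product of ribbons: an ascent at the seam
  merges the adjacent parts, a descent keeps them apart.\<close>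

lemma descent_comp_append:
  assumes "u \<noteq> []" "v \<noteq> []"
  shows "descent_comp (u @ v) =
    (if last u < hd v
     then butlast (descent_comp u) @ (last (descent_comp u) + hd (descent_comp v)) # tl (descent_comp v)
     else descent_comp u @ descent_comp v)"
  using assms
proof (induction u rule: descent_comp.induct)
  case (2 a)
  then obtain b w where "v = b # w" by (cases v) auto
  then show ?case by auto
next
  case (3 a b w)
  obtain h t where ht: "descent_comp (b # w) = h # t"
    using descent_comp_eq_Nil_iff by (metis list.discI list.exhaust)
  have IH: "descent_comp (b # w @ v) =
    (if last (b # w) < hd v
     then butlast (h # t) @ (last (h # t) + hd (descent_comp v)) # tl (descent_comp v)
     else (h # t) @ descent_comp v)"
    using 3 ht by (cases "a < b") simp_all
  show ?case
    by (cases t) (simp_all add: IH ht del: last.simps butlast.simps, auto)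
qed simp

text \<open>The cut of a composition at height \<open>d\<close>; a part that straddles
  \<open>d\<close> is divided. It undoes both concatenation and merging, so a term of a product and
  the size of its left factor determine both factors.\<close>

fun comp_split :: "nat \<Rightarrow> nat list \<Rightarrow> nat list \<times> nat list"
  where
    "comp_split d [] = ([], [])"
  | "comp_split d (k # K) =
      (if d = 0 then ([], k # K) else if d < k then ([d], (k - d) # K)
       else (k # fst (comp_split (d - k) K), snd (comp_split (d - k) K)))"

lemma comp_split_0 [simp]: "comp_split 0 K = ([], K)"
  by (cases K) auto

lemma comp_split_append:
  assumes "\<forall>i\<in>set I. 1 \<le> i"
  shows "comp_split (sum_list I) (I @ J) = (I, J)"
  using assms by (induction I) auto

lemma comp_split_merge:
  assumes "\<forall>i\<in>set I. 1 \<le> i" "I \<noteq> []" "1 \<le> j"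
  shows "comp_split (sum_list I) (butlast I @ (last I + j) # J) = (I, j # J)"
  using assms
proof (induction I)
  case (Cons i I)
  then show ?case by (cases "I = []") auto
qed simp

lemma comp_split_ribbon_mult:
  assumes "ribbon_mult I J K \<noteq> 0" "\<forall>i\<in>set I. 1 \<le> i" "\<forall>j\<in>set J. 1 \<le> j"
  shows "comp_split (sum_list I) K = (I, J)"
proof (cases "I = [] \<or> J = []")
  case True
  then show ?thesis
    using assms comp_split_append[of I J] by (auto simp: ribbon_mult_def ribbon_def split: if_splits)
next
  case False
  then obtain j J' where J: "J = j # J'" by (cases J) auto
  with False assms have "K = I @ J \<or> K = butlast I @ (last I + j) # J'"
    by (auto simp: ribbon_mult_def ribbon_def split: if_splits)
  then show ?thesis
    using comp_split_append[of I J] comp_split_merge[of I j J'] assms False J by auto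
qed

lemma ribbon_mult_descent_comp:
  "ribbon_mult (descent_comp u) (descent_comp v) (descent_comp (u @ v)) = 1"
proof (cases "u = [] \<or> v = []")
  case True
  then show ?thesis by (auto simp: ribbon_mult_def ribbon_def)
next
  case False
  define I J where "I = descent_comp u" "J = descent_comp v"
  with False have "I \<noteq> []" "J \<noteq> []" by auto
  \<comment> \<open>The two terms of the product differ in length, so they cannot coincide and the
    coefficient is 1 rather than 2.\<close>
  then have "length (butlast I @ (last I + hd J) # tl J) \<noteq> length (I @ J)"
    by (cases I; cases J) auto
  then have "butlast I @ (last I + hd J) # tl J \<noteq> I @ J"
    by metis
  then show ?thesis
    using False \<open>I \<noteq> []\<close> \<open>J \<noteq> []\<close> descent_comp_append[of u v]
    by (auto simp: I_J_def[symmetric] ribbon_mult_def ribbon_def)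
qed

text \<open>The prefix of length \<open>d\<close> and the remaining suffix do contribute, and by
  \<open>comp_split\<close> no other pair of these degrees can.\<close>

lemma ribbon_mult_descent_comp_eq:
  assumes "d \<le> length w" "I \<in> compositions d" "J \<in> compositions (length w - d)"
  shows "ribbon_mult I J (descent_comp w) =
    of_bool (I = descent_comp (take d w) \<and> J = descent_comp (drop d w))"
proof -
  have *: "ribbon_mult (descent_comp (take d w)) (descent_comp (drop d w)) (descent_comp w) = 1"
    using ribbon_mult_descent_comp[of "take d w" "drop d w"] by simp
  have "comp_split d (descent_comp w) = (descent_comp (take d w), descent_comp (drop d w))"
    using comp_split_ribbon_mult[of "descent_comp (take d w)" "descent_comp (drop d w)" "descent_comp w"]
      * descent_comp_in_compositions[of "take d w"] descent_comp_in_compositions[of "drop d w"] assms(1)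
    by (simp add: compositions_def min_absorb2)
  moreover have "comp_split d (descent_comp w) = (I, J)" if "ribbon_mult I J (descent_comp w) \<noteq> 0"
    using comp_split_ribbon_mult[OF that] assms by (auto simp: compositions_def)
  ultimately show ?thesis
    using * by (cases "ribbon_mult I J (descent_comp w) = 0") auto
qed

text \<open>The external product of series becomes deconcatenation of words.\<close>

definition conv :: "('a list \<Rightarrow> rat) \<Rightarrow> ('a list \<Rightarrow> rat) \<Rightarrow> 'a list \<Rightarrow> rat"
  where "conv f g w = (\<Sum>d\<le>length w. f (take d w) * g (drop d w))"

lemma conv_Nil: "conv f g [] = f [] * g []"
  by (simp add: conv_def)

lemma conv_Cons: "conv f g (a # w) = f [] * g (a # w) + conv (\<lambda>u. f (a # u)) g w"
  by (simp add: conv_def sum.atMost_Suc_shift del: sum.atMost_Suc)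

lemma conv_add_left: "conv (\<lambda>u. f u + f' u) g w = conv f g w + conv f' g w"
  by (simp add: conv_def sum.distrib algebra_simps)

lemma conv_scale_left: "conv (\<lambda>u. c * f u) g w = c * conv f g w"
  by (simp add: conv_def sum_distrib_left algebra_simps)

text \<open>Taking off the first letter moves it into the left factor, which becomes
  \<open>\<lambda>u. f (a # u)\<close>; hence the induction generalises over \<open>f\<close> and
  uses linearity in the left argument.\<close>

lemma conv_assoc: "conv (conv f g) h w = conv f (conv g h) w"
  by (induction w arbitrary: f)
    (simp_all add: conv_Nil conv_Cons conv_add_left conv_scale_left algebra_simps)

text \<open>For each degree of the left factor exactly one pair of compositions contributes, so the
  triple sum collapses to the cuts of the word.\<close>

lemma ext_prod_descent_comp:
  "(F \<star> G) (descent_comp w) = conv (\<lambda>u. F (descent_comp u)) (\<lambda>u. G (descent_comp u)) w"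
proof -
  have len: "sum_list (descent_comp w) = length w"
    using descent_comp_in_compositions[of w] by (simp add: compositions_def)
  have "(\<Sum>I\<in>compositions d. \<Sum>J\<in>compositions (length w - d).
      F I * G J * ribbon_mult I J (descent_comp w))
      = F (descent_comp (take d w)) * G (descent_comp (drop d w))" if "d \<le> length w" for d
  proof -
    have in1: "descent_comp (take d w) \<in> compositions d"
      using descent_comp_in_compositions[of "take d w"] that by (simp add: min_absorb2)
    have in2: "descent_comp (drop d w) \<in> compositions (length w - d)"
      using descent_comp_in_compositions[of "drop d w"] by simp
    have "(\<Sum>I\<in>compositions d. \<Sum>J\<in>compositions (length w - d).
        F I * G J * ribbon_mult I J (descent_comp w))
      = (\<Sum>I\<in>compositions d. \<Sum>J\<in>compositions (length w - d).
          if I = descent_comp (take d w) then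
            (if J = descent_comp (drop d w) then F I * G J else 0) else 0)"
      by (intro sum.cong refl) (simp add: ribbon_mult_descent_comp_eq[OF that])
    also have "\<dots> = (\<Sum>I\<in>compositions d. if I = descent_comp (take d w) then
        (\<Sum>J\<in>compositions (length w - d). if J = descent_comp (drop d w) then F I * G J else 0) else 0)"
      by (intro sum.cong refl) simp
    also have "\<dots> = F (descent_comp (take d w)) * G (descent_comp (drop d w))"
      using in1 in2 by (simp add: sum.delta finite_compositions)
    finally show ?thesis .
  qed
  then show ?thesis
    by (simp add: ext_prod_def conv_def len)
qed

section \<open>Descent sets determine compositions\<close>

lemma descent_set_Cons:
  "descent_set (i # I) = (if I = [] then {} else insert i ((+) i ` descent_set I))"
proof (cases "I = []")
  case False
  have im: "descent_set L = (\<lambda>k. sum_list (take k L)) ` {1..<length L}" for L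
    by (auto simp: descent_set_def)
  have "{1..<length (i # I)} = Suc ` insert 0 {1..<length I}"
  proof -
    have "insert 0 {1..<length I} = {0..<length I}"
      using False by auto
    then show ?thesis
      by (simp only: image_Suc_atLeastLessThan) simp
  qed
  then have "descent_set (i # I) = (\<lambda>k. sum_list (take k (i # I))) ` Suc ` insert 0 {1..<length I}"
    unfolding im by (rule arg_cong)
  also have "\<dots> = insert i ((+) i ` descent_set I)"
    by (simp add: im image_image del: image_Suc_atLeastLessThan)
  finally show ?thesis
    using False by simp
qed (auto simp: descent_set_def)

lemma descent_set_inj:
  assumes "I \<in> compositions m" "J \<in> compositions m" "descent_set I = descent_set J"
  shows "I = J"
  using assms
proof (induction I arbitrary: J m)
  case Nil
  then show ?case by (cases J) (auto simp: compositions_def)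
next
  case (Cons i I)
  then obtain j J' where J: "J = j # J'" by (cases J) (auto simp: compositions_def)
  show ?case
  proof (cases "I = []")
    case True
    with Cons.prems J show ?thesis
      by (auto simp: descent_set_Cons compositions_def split: if_splits)
  next
    case False
    with Cons.prems J have nE: "J' \<noteq> []" by (auto simp: descent_set_Cons split: if_splits)
    have eq: "insert i ((+) i ` descent_set I) = insert j ((+) j ` descent_set J')"
      using Cons.prems(3) False nE J by (simp add: descent_set_Cons)
    \<comment> \<open>Every member of a shifted set is at least the shift, so each first part is
      bounded by the other; both are the least descent.\<close>
    then have "i \<in> insert j ((+) j ` descent_set J')" "j \<in> insert i ((+) i ` descent_set I)"
      by blast+
    then have ij: "i = j" by auto
    \<comment> \<open>Positive parts keep 0 out of descent sets, so the first part can be cancelled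
      from both sides before shifting back.\<close>
    have pos: "0 \<notin> descent_set L" if "\<forall>i\<in>set L. 1 \<le> i" for L
      using that by (cases L) (auto simp: descent_set_Cons descent_set_def[of "[]"])
    have "i \<notin> (+) i ` descent_set I" "i \<notin> (+) i ` descent_set J'"
      using pos[of I] pos[of J'] Cons.prems J by (auto simp: compositions_def)
    with eq ij have "(+) i ` descent_set I = (+) i ` descent_set J'"
      by (metis insert_ident)
    then have "descent_set I = descent_set J'"
      by (simp add: inj_image_eq_iff)
    moreover have "I \<in> compositions (m - i)" "J' \<in> compositions (m - i)"
      using Cons.prems J ij by (auto simp: compositions_def)
    ultimately show ?thesis using Cons.IH ij J by blast
  qed
qed

lemma descent_set_descent_comp:
  "descent_set (descent_comp w) = {i. 1 \<le> i \<and> i < length w \<and> \<not> w ! (i - 1) < w ! i}"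
proof (induction w rule: descent_comp.induct)
  case (3 a b w)
  let ?D = "\<lambda>w :: nat list. {i. 1 \<le> i \<and> i < length w \<and> \<not> w ! (i - 1) < w ! i}"
  obtain h t where ht: "descent_comp (b # w) = h # t"
    using descent_comp_eq_Nil_iff by (metis list.discI list.exhaust)
  have D: "?D (a # b # w) = (if a < b then {} else {1}) \<union> Suc ` ?D (b # w)"
  proof (intro set_eqI)
    fix i
    show "i \<in> ?D (a # b # w) \<longleftrightarrow> i \<in> (if a < b then {} else {1}) \<union> Suc ` ?D (b # w)"
    proof (cases i)
      case (Suc i')
      then show ?thesis by (cases i') auto
    qed auto
  qed
  have IH: "descent_set (h # t) = ?D (b # w)"
    using 3 unfolding ht by blast
  have "descent_set (descent_comp (a # b # w)) =
      (if a < b then {} else {1}) \<union> Suc ` descent_set (h # t)"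
    by (simp add: ht descent_set_Cons image_image)
  then show ?case
    unfolding D IH .
qed (auto simp: descent_set_def)

definition word :: "nat \<Rightarrow> (nat \<Rightarrow> nat) \<Rightarrow> nat list"
  where "word n \<sigma> = map \<sigma> [1..<Suc n]"

lemma length_word [simp]: "length (word n \<sigma>) = n"
  by (simp add: word_def)

text \<open>Descent sets separate the compositions of \<open>n\<close>, so at a given permutation
  only the summand of its own descent composition survives.\<close>

lemma component_eq:
  "component n F \<sigma> = (if \<sigma> permutes {1..n} then F (descent_comp (word n \<sigma>)) else 0)"
proof -
  have sum_apply: "(\<Sum>I\<in>S. f I) \<sigma> = (\<Sum>I\<in>S. f I \<sigma>)" for S :: "nat list set" and f
    by (induction S rule: infinite_finite_induct) auto
  have 1: "component n F \<sigma> =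
    (\<Sum>I\<in>compositions n. F I * of_bool (\<sigma> permutes {1..n} \<and> Des n \<sigma> = descent_set I))"
    by (simp add: component_def sum_apply qscale_def perm_sum_def)
  show ?thesis
  proof (cases "\<sigma> permutes {1..n}")
    case True
    have ne: "\<sigma> i \<noteq> \<sigma> (Suc i)" for i
      by (simp add: inj_eq[OF permutes_inj[OF True]])
    have nth: "word n \<sigma> ! i = \<sigma> (Suc i)" if "i < n" for i
      using that by (simp add: word_def del: upt_Suc)
    have "Des n \<sigma> = descent_set (descent_comp (word n \<sigma>))"
      unfolding descent_set_descent_comp Des_def length_word
    proof (intro Collect_cong conj_cong refl)
      fix i assume "1 \<le> i" "i < n"
      then show "\<sigma> (i + 1) < \<sigma> i \<longleftrightarrow> \<not> word n \<sigma> ! (i - 1) < word n \<sigma> ! i"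
        using ne[of i] by (simp add: nth) linarith
    qed
    then have "Des n \<sigma> = descent_set I \<longleftrightarrow> I = descent_comp (word n \<sigma>)" if "I \<in> compositions n" for I
      using descent_set_inj[OF that] descent_comp_in_compositions[of "word n \<sigma>"] by auto
    then have "component n F \<sigma> =
      (\<Sum>I\<in>compositions n. if I = descent_comp (word n \<sigma>) then F I else 0)"
      unfolding 1 using True by (intro sum.cong) auto
    then show ?thesis
      using True descent_comp_in_compositions[of "word n \<sigma>"] by (simp add: finite_compositions)
  qed (simp add: 1)
qed

text \<open>
  A list of signs \<open>A\<close> (\<open>True\<close> for \<open>+\<close>) stands for the external product of the corresponding
  series \<open>V\<^sub>1\<^sup>\<plusminus>\<close>; \<open>shelf A w\<close> is the coefficient in it of the ribbon of the word \<open>w\<close>.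
\<close>

definition mono_word :: "bool \<Rightarrow> nat list \<Rightarrow> rat"
  where "mono_word s w = of_bool (successively (\<lambda>a b. (a < b) = s) w)"

primrec shelf :: "bool list \<Rightarrow> nat list \<Rightarrow> rat"
  where
    "shelf [] = (\<lambda>w. of_bool (w = []))"
  | "shelf (s # A) = conv (mono_word s) (shelf A)"

lemma V1_plus_descent_comp: "V1_plus (descent_comp w) = mono_word True w"
proof -
  have "w \<noteq> [] \<Longrightarrow> (\<exists>i\<ge>Suc 0. descent_comp w = [i]) \<longleftrightarrow> successively (<) w"
  proof (induction w rule: descent_comp.induct)
    case (3 a b w)
    obtain h t where ht: "descent_comp (b # w) = h # t"
      using descent_comp_eq_Nil_iff by (metis list.discI list.exhaust)
    moreover have "h \<ge> 1"
      using descent_comp_in_compositions[of "b # w"] ht by (auto simp: compositions_def)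
    ultimately show ?case using 3 by auto
  qed auto
  then show ?thesis
    by (cases "w = []") (auto simp: V1_plus_def mono_word_def)
qed

lemma V1_minus_descent_comp: "V1_minus (descent_comp w) = mono_word False w"
proof -
  have "(\<exists>i. descent_comp w = replicate i 1) \<longleftrightarrow> successively (\<lambda>a b. \<not> a < b) w"
  proof (induction w rule: descent_comp.induct)
    case 2
    then show ?case by (auto intro: exI[of _ 1])
  next
    case (3 a b w)
    obtain h t where ht: "descent_comp (b # w) = h # t"
      using descent_comp_eq_Nil_iff by (metis list.discI list.exhaust)
    moreover have "h \<ge> 1"
      using descent_comp_in_compositions[of "b # w"] ht by (auto simp: compositions_def)
    moreover have "(\<exists>i. 1 # L = replicate i (1::nat)) \<longleftrightarrow> (\<exists>i. L = replicate i 1)" for L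
      by (metis list.inject replicate_Suc length_replicate length_Suc_conv)
    moreover have "Suc h # t \<noteq> replicate i 1" for i
      using \<open>h \<ge> 1\<close> by (cases i) auto
    ultimately show ?case using 3 by auto
  qed auto
  then show ?thesis
    by (auto simp: V1_minus_def mono_word_def)
qed

primrec alt :: "nat \<Rightarrow> bool \<Rightarrow> bool list"
  where
    "alt 0 s = []"
  | "alt (Suc k) s = s # alt k (\<not> s)"

lemma length_alt [simp]: "length (alt k s) = k"
  by (induction k arbitrary: s) auto

lemma ext_power_descent_comp:
  "ext_power (V1_plus \<star> V1_minus) k (descent_comp w) = shelf (alt (2 * k) True) w"
  "ext_power (V1_minus \<star> V1_plus) k (descent_comp w) = shelf (alt (2 * k) False) w"
proof (induction k arbitrary: w)
  case 0
  { case 1 show ?case by (simp add: ribbon_def) }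
  { case 2 show ?case by (simp add: ribbon_def) }
next
  case (Suc k)
  note simps = ext_prod_descent_comp V1_plus_descent_comp V1_minus_descent_comp Suc conv_assoc
  { case 1 show ?case by (simp add: simps) }
  { case 2 show ?case by (simp add: simps) }
qed

lemma V_plus_descent_comp: "V_plus k (descent_comp w) = shelf (alt k True) w"
proof (cases "even k")
  case True
  then show ?thesis by (auto simp: V_plus_def ext_power_descent_comp)
next
  case False
  then obtain l where "k = Suc (2 * l)" by (auto elim: oddE)
  then show ?thesis
    by (simp add: V_plus_def ext_prod_descent_comp ext_power_descent_comp V1_plus_descent_comp)
qed

lemma V_minus_descent_comp: "V_minus k (descent_comp w) = shelf (alt k False) w"
proof (cases "even k")
  case True
  then show ?thesis by (auto simp: V_minus_def ext_power_descent_comp)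
next
  case False
  then obtain l where "k = Suc (2 * l)" by (auto elim: oddE)
  then show ?thesis
    by (simp add: V_minus_def ext_prod_descent_comp ext_power_descent_comp V1_minus_descent_comp)
qed

text \<open>The degree \<open>n\<close> component of the product of series encoded by
  \<open>A\<close>, as an element of the group algebra.\<close>

definition shelf_sum :: "nat \<Rightarrow> bool list \<Rightarrow> (nat \<Rightarrow> nat) \<Rightarrow> rat"
  where "shelf_sum n A = (\<lambda>\<sigma>. if \<sigma> permutes {1..n} then shelf A (word n \<sigma>) else 0)"

lemma Vp_eq: "Vp k n = shelf_sum n (alt k True)"
  by (simp add: fun_eq_iff Vp_def component_eq V_plus_descent_comp shelf_sum_def)

lemma Vm_eq: "Vm k n = shelf_sum n (alt k False)"
  by (simp add: fun_eq_iff Vm_def component_eq V_minus_descent_comp shelf_sum_def)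

lemma V_eq: "V k n = Vp k n + Vm k n"
  by (simp add: fun_eq_iff V_def Vp_def Vm_def component_eq)

subsection \<open>Generating functions\<close>

unbundle fps_syntax

lemma shelf_Nil [simp]: "shelf A [] = 1"
  by (induction A) (auto simp: conv_Nil mono_word_def)

lemma shelf_singleton: "shelf A [a] = of_nat (length A)"
  by (induction A) (auto simp: conv_Cons conv_Nil mono_word_def)

text \<open>The block of sign \<open>s\<close> is empty, or it contains \<open>a\<close>. In the
  latter case deleting \<open>a\<close> leaves a division of \<open>b # w\<close>: with arbitrary
  first block if the step from \<open>a\<close> to \<open>b\<close> agrees with \<open>s\<close>,
  and with empty first block otherwise.\<close>

lemma shelf_Cons_Cons:
  "shelf (s # A) (a # b # w) =
    shelf A (a # b # w) + (if (a < b) = s then shelf (s # A) (b # w) else shelf A (b # w))"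
proof -
  have "mono_word s (a # b # u) = of_bool ((a < b) = s) * mono_word s (b # u)" for u
    by (auto simp: mono_word_def)
  moreover have "mono_word s [] = 1" "mono_word s [x] = 1" for x
    by (simp_all add: mono_word_def)
  ultimately show ?thesis
    by (simp add: conv_Cons conv_scale_left)
qed

definition shelf_fps :: "bool \<Rightarrow> nat list \<Rightarrow> rat fps"
  where "shelf_fps s w = Abs_fps (\<lambda>k. shelf (alt k s) w)"

lemma shelf_fps_singleton: "shelf_fps s [a] * (1 - fps_X)\<^sup>2 = fps_X"
proof -
  \<comment> \<open>One letter can go into any of the \<open>k\<close> blocks, so the series is the
    sum of all \<open>k X^k\<close>; each factor \<open>1 - X\<close> takes differences
    once.\<close>
  have 1: "shelf_fps s [a] * (1 - fps_X) = Abs_fps (\<lambda>k. of_bool (k > 0))"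
  proof (rule fps_ext)
    fix k
    show "(shelf_fps s [a] * (1 - fps_X)) $ k = Abs_fps (\<lambda>k. of_bool (k > 0)) $ k"
      by (cases k) (simp_all add: shelf_fps_def shelf_singleton algebra_simps)
  qed
  have "Abs_fps (\<lambda>k. of_bool (k > 0)) * (1 - fps_X) = (fps_X :: rat fps)"
  proof (rule fps_ext)
    fix k
    show "(Abs_fps (\<lambda>k. of_bool (k > 0)) * (1 - fps_X)) $ k = (fps_X :: rat fps) $ k"
      by (cases k) (auto simp: algebra_simps fps_X_nth)
  qed
  with 1 show ?thesis
    by (simp add: power2_eq_square flip: mult.assoc)
qed

lemma shelf_fps_Cons_Cons:
  "shelf_fps s (a # b # w) * (1 - fps_X\<^sup>2) =
    (if (a < b) = s then 1 + fps_X\<^sup>2 else 2 * fps_X) * shelf_fps (a < b) (b # w)"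
proof -
  let ?v = "b # w"
  \<comment> \<open>Dropping the first sign of an alternating word flips the starting sign and
    lowers the length by one, which is the factor \<open>fps_X\<close>.\<close>
  have eq: "shelf_fps s (a # ?v) = fps_X * shelf_fps (\<not> s) (a # ?v) +
    (if (a < b) = s then shelf_fps s ?v else fps_X * shelf_fps (\<not> s) ?v)" for s
  proof (rule fps_ext)
    fix k
    show "shelf_fps s (a # ?v) $ k = (fps_X * shelf_fps (\<not> s) (a # ?v) +
      (if (a < b) = s then shelf_fps s ?v else fps_X * shelf_fps (\<not> s) ?v)) $ k"
    proof (cases k)
      case (Suc l)
      then show ?thesis
        by (simp add: shelf_fps_def shelf_Cons_Cons del: shelf.simps(2))
    qed (simp add: shelf_fps_def)
  qed
  show ?thesis
  proof (cases "(a < b) = s")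
    case True
    \<comment> \<open>The instances for \<open>s\<close> and \<open>\<not> s\<close> form a linear
      system for the two series of \<open>a # b # w\<close>; the one for \<open>\<not> s\<close> is
      eliminated.\<close>
    have 1: "shelf_fps s (a # ?v) = fps_X * shelf_fps (\<not> s) (a # ?v) + shelf_fps s ?v"
      using eq[of s] True by simp
    have 2: "shelf_fps (\<not> s) (a # ?v) = fps_X * shelf_fps s (a # ?v) + fps_X * shelf_fps s ?v"
      using eq[of "\<not> s"] True by simp
    have "shelf_fps s (a # ?v) * (1 - fps_X\<^sup>2) = (1 + fps_X\<^sup>2) * shelf_fps s ?v"
      using 1 2 by algebra
    with True show ?thesis by simp
  next
    case False
    then have s: "(a < b) = (\<not> s)" by auto
    have 1: "shelf_fps s (a # ?v) = fps_X * shelf_fps (\<not> s) (a # ?v) + fps_X * shelf_fps (\<not> s) ?v"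
      using eq[of s] False by simp
    have 2: "shelf_fps (\<not> s) (a # ?v) = fps_X * shelf_fps s (a # ?v) + shelf_fps (\<not> s) ?v"
      using eq[of "\<not> s"] s by simp
    have "shelf_fps s (a # ?v) * (1 - fps_X\<^sup>2) = (2 * fps_X) * shelf_fps (\<not> s) ?v"
      using 1 2 by algebra
    with s show ?thesis by simp
  qed
qed

fun changes :: "bool \<Rightarrow> nat list \<Rightarrow> nat"
  where
    "changes s [] = 0"
  | "changes s [a] = 0"
  | "changes s (a # b # w) = (if (a < b) = s then 0 else 1) + changes (a < b) (b # w)"

lemma changes_less: "w \<noteq> [] \<Longrightarrow> changes s w < length w"
  by (induction s w rule: changes.induct) auto

text \<open>Each step of the word contributes \<open>1 + X^2\<close> or, at a sign change,
  \<open>2 X\<close>, over the denominator \<open>1 - X^2\<close>. A single letter starts with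
  \<open>X / (1 - X)^2 = X (1 + X)^2 / (1 - X^2)^2\<close>.\<close>

lemma shelf_fps_eq:
  assumes "w \<noteq> []"
  shows "shelf_fps s w * (1 - fps_X\<^sup>2) ^ (length w + 1) =
    fps_X * (1 + fps_X)\<^sup>2 * (1 + fps_X\<^sup>2) ^ (length w - 1 - changes s w) * (2 * fps_X) ^ changes s w"
  using assms
proof (induction s w rule: changes.induct)
  case (2 s a)
  have "(1 - fps_X\<^sup>2)\<^sup>2 = (1 - fps_X)\<^sup>2 * (1 + fps_X :: rat fps)\<^sup>2"
    by algebra
  then show ?case
    using shelf_fps_singleton[of s a] by (simp add: numeral_2_eq_2 flip: mult.assoc)
next
  case (3 s a b w)
  let ?c = "changes (a < b) (b # w)"
  have c: "?c \<le> length w"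
    using changes_less[of "b # w" "a < b"] by simp
  have "shelf_fps s (a # b # w) * (1 - fps_X\<^sup>2) ^ (length (a # b # w) + 1) =
    shelf_fps s (a # b # w) * (1 - fps_X\<^sup>2) * (1 - fps_X\<^sup>2) ^ (length (b # w) + 1)"
    by (simp add: mult.assoc)
  also have "\<dots> = (if (a < b) = s then 1 + fps_X\<^sup>2 else 2 * fps_X) *
      (shelf_fps (a < b) (b # w) * (1 - fps_X\<^sup>2) ^ (length (b # w) + 1))"
    unfolding shelf_fps_Cons_Cons by (simp only: mult.assoc)
  also have "\<dots> = (if (a < b) = s then 1 + fps_X\<^sup>2 else 2 * fps_X) *
      (fps_X * (1 + fps_X)\<^sup>2 * (1 + fps_X\<^sup>2) ^ (length w - ?c) * (2 * fps_X) ^ ?c)"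
    using 3 by simp
  also have "\<dots> = fps_X * (1 + fps_X)\<^sup>2 *
      (1 + fps_X\<^sup>2) ^ (length (a # b # w) - 1 - changes s (a # b # w)) *
      (2 * fps_X) ^ changes s (a # b # w)"
    using c by (cases "(a < b) = s") (simp_all add: Suc_diff_le mult_ac)
  finally show ?case .
qed simp

section \<open>Parity and lowest coefficients of the closed form\<close>

definition even_fps :: "rat fps \<Rightarrow> bool"
  where "even_fps f \<longleftrightarrow> (\<forall>k. odd k \<longrightarrow> f $ k = 0)"

lemma even_fps_mult:
  assumes "even_fps f" "even_fps g"
  shows "even_fps (f * g)"
  unfolding even_fps_def
proof (intro allI impI)
  fix k :: nat
  assume "odd k"
  have "f $ i * g $ (k - i) = 0" if "i \<in> {0..k}" for i
  proof (cases "odd i")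
    case False
    with \<open>odd k\<close> that have "odd (k - i)" by auto
    with assms show ?thesis by (simp add: even_fps_def)
  qed (use assms in \<open>simp add: even_fps_def\<close>)
  then show "(f * g) $ k = 0"
    unfolding fps_mult_nth by (rule sum.neutral[OF ballI])
qed

lemma even_fps_power: "even_fps f \<Longrightarrow> even_fps (f ^ m)"
  by (induction m) (simp_all add: even_fps_mult, simp add: even_fps_def)

lemma even_fps_X_power2: "even_fps (1 + fps_X\<^sup>2)" "even_fps (1 - fps_X\<^sup>2)"
  by (auto simp: even_fps_def fps_X_power_iff elim: oddE)

text \<open>The series \<open>1 / (1 - X^2)\<close>, given by its coefficients so that its evenness
  is visible.\<close>

definition geom_fps :: "rat fps"
  where "geom_fps = Abs_fps (\<lambda>k. of_bool (even k))"

lemma even_geom_fps: "even_fps geom_fps"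
  by (simp add: even_fps_def geom_fps_def)

lemma geom_fps_mult: "(1 - fps_X\<^sup>2) * geom_fps = 1"
proof (rule fps_ext)
  fix k
  have "((1 - fps_X\<^sup>2) * geom_fps) $ k = geom_fps $ k - (fps_X * (fps_X * geom_fps)) $ k"
    by (simp add: algebra_simps power2_eq_square)
  also have "\<dots> = 1 $ k"
    by (cases k; cases "k - 1") (auto simp: geom_fps_def)
  finally show "((1 - fps_X\<^sup>2) * geom_fps) $ k = 1 $ k" .
qed

text \<open>The even factor of the closed form, with constant term 1; what mixes parities is
  \<open>(1 + X)^2\<close> alone.\<close>

definition even_part :: "nat \<Rightarrow> nat \<Rightarrow> rat fps"
  where "even_part n c = (1 + fps_X\<^sup>2) ^ (n - 1 - c) * geom_fps ^ (n + 1)"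

lemma even_fps_even_part: "even_fps (even_part n c)"
  unfolding even_part_def
  by (intro even_fps_mult even_fps_power even_fps_X_power2 even_geom_fps)

lemma even_part_0 [simp]: "even_part n c $ 0 = 1"
  by (simp add: even_part_def geom_fps_def fps_nth_power_0)

definition coef_fps :: "nat \<Rightarrow> nat \<Rightarrow> rat fps"
  where "coef_fps n c = fps_X * (1 + fps_X)\<^sup>2 * (2 * fps_X) ^ c * even_part n c"

text \<open>By \<open>shelf_alt_eq_coef\<close> this is the coefficient of an alternating product of
  \<open>k\<close> series at any nonempty word of length \<open>n\<close> with \<open>c\<close> sign
  changes.\<close>

definition coef :: "nat \<Rightarrow> nat \<Rightarrow> nat \<Rightarrow> rat"
  where "coef n c k = coef_fps n c $ k"

lemma shelf_alt_eq_coef: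
  assumes "w \<noteq> []"
  shows "shelf (alt k s) w = coef (length w) (changes s w) k"
proof -
  let ?m = "length w + 1"
  have "(1 - fps_X\<^sup>2) ^ ?m * geom_fps ^ ?m = (1 :: rat fps)"
    by (simp only: geom_fps_mult power_one flip: power_mult_distrib)
  then have "shelf_fps s w = shelf_fps s w * (1 - fps_X\<^sup>2) ^ ?m * geom_fps ^ ?m"
    by (simp only: mult.assoc mult_1_right)
  also have "\<dots> = coef_fps (length w) (changes s w)"
    unfolding shelf_fps_eq[OF assms] by (simp only: coef_fps_def even_part_def mult_ac)
  finally have "shelf_fps s w $ k = coef_fps (length w) (changes s w) $ k"
    by simp
  then show ?thesis
    by (simp add: shelf_fps_def coef_def)
qed

text \<open>Splitting off \<open>X^(c+1)\<close> exhibits the order \<open>c + 1\<close> of the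
  series; the two lowest coefficients, \<open>2^c\<close> and \<open>2^(c+1)\<close>, become the
  diagonal entries of the triangular systems.\<close>

lemma coef_fps_eq:
  "coef_fps n c = fps_const (2 ^ c) * (fps_X ^ Suc c * ((1 + 2 * fps_X + fps_X\<^sup>2) * even_part n c))"
proof -
  have "(2 * fps_X) ^ c = fps_const (2 ^ c) * (fps_X ^ c :: rat fps)"
    by (simp add: power_mult_distrib fps_const_power numeral_fps_const)
  moreover have "(1 + fps_X)\<^sup>2 = 1 + 2 * fps_X + (fps_X\<^sup>2 :: rat fps)"
    by algebra
  ultimately show ?thesis
    by (simp add: coef_fps_def mult_ac)
qed

lemma coef_eq_0: "k \<le> c \<Longrightarrow> coef n c k = 0"
  by (simp add: coef_def coef_fps_eq fps_X_power_mult_nth del: power_Suc)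

lemma coef_Suc: "coef n c (Suc c) = 2 ^ c"
  by (simp add: coef_def coef_fps_eq fps_X_power_mult_nth del: power_Suc)

lemma coef_Suc_Suc: "coef n c (Suc (Suc c)) = 2 ^ Suc c"
proof -
  \<comment> \<open>An even series has no linear term, so the 2 comes from \<open>2 * fps_X\<close>
    alone.\<close>
  have "((1 + 2 * fps_X + fps_X\<^sup>2) * even_part n c) $ 1 = 2"
    using even_fps_even_part[of n c]
    by (simp add: distrib_right power2_eq_square mult.assoc even_fps_def fps_mult_nth_1)
  then show ?thesis
    by (simp add: coef_def coef_fps_eq fps_X_power_mult_nth del: power_Suc One_nat_def) simp
qed

text \<open>As \<open>(1 + X^2) - 2 X = (1 - X)^2\<close>, the two closed forms differ by
  \<open>X (2 X)^c (1 - X^2)^2\<close> times an even series, hence only in degrees of the parity of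
  \<open>c + 1\<close>. The bound on \<open>c\<close> provides the factor \<open>1 + X^2\<close>
  that is traded for \<open>2 X\<close>.\<close>

lemma coef_lump:
  assumes "Suc c < n" "even k = even c"
  shows "coef n (Suc c) k = coef n c k"
proof -
  define E where "E = (1 - fps_X\<^sup>2)\<^sup>2 * even_part n (Suc c)"
  have E: "even_fps E"
    unfolding E_def by (intro even_fps_mult even_fps_power even_fps_X_power2 even_fps_even_part)
  have "n - 1 - c = Suc (n - 1 - Suc c)"
    using assms by simp
  then have 1: "even_part n c = (1 + fps_X\<^sup>2) * even_part n (Suc c)"
    by (simp add: even_part_def mult.assoc)
  have "coef_fps n c - coef_fps n (Suc c) = (2 * fps_X) ^ c * (fps_X * E)"
    unfolding coef_fps_def 1 E_def power_Suc by algebra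
  also have "\<dots> = fps_const (2 ^ c) * (fps_X ^ Suc c * E)"
    by (simp add: power_mult_distrib fps_const_power numeral_fps_const mult_ac)
  finally have "coef n c k - coef n (Suc c) k = (fps_const (2 ^ c) * (fps_X ^ Suc c * E)) $ k"
    by (metis coef_def fps_sub_nth)
  also have "\<dots> = 0"
  proof (cases "k \<le> c")
    case True
    then show ?thesis by (simp add: fps_X_power_mult_nth del: power_Suc)
  next
    case False
    with assms have "odd (k - Suc c)" by auto
    with E show ?thesis by (simp add: fps_X_power_mult_nth even_fps_def del: power_Suc)
  qed
  finally show ?thesis by simp
qed

subsection \<open>Internal products\<close>

text \<open>Pairs are (label, value); sorting by labels means listing the values in this
  order.\<close>

definition letter_less :: "bool list \<Rightarrow> nat \<times> nat \<Rightarrow> nat \<times> nat \<Rightarrow> bool"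
  where "letter_less A x y \<longleftrightarrow>
    fst x < fst y \<or> fst x = fst y \<and> (if A ! fst x then snd x < snd y else snd y < snd x)"

lemma letter_less_irrefl: "\<not> letter_less A x x"
  by (simp add: letter_less_def)

lemma letter_less_asym: "letter_less A x y \<Longrightarrow> \<not> letter_less A y x"
  by (auto simp: letter_less_def)

text \<open>\<open>us\<close> labels the positions of \<open>w\<close>; membership says that
  \<open>w\<close> is what sorting by these labels produces.\<close>

definition sorting_words :: "bool list \<Rightarrow> nat list \<Rightarrow> nat list set"
  where "sorting_words A w = {us. length us = length w \<and> set us \<subseteq> {..<length A} \<and>
    sorted_wrt (letter_less A) (zip us w)}"

lemma finite_sorting_words: "finite (sorting_words A w)"
  by (rule finite_subset[of _ "{us. set us \<subseteq> {..<length A} \<and> length us = length w}"])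
    (auto simp: sorting_words_def finite_lists_length_eq)

lemma sorted_wrt_distinct_iff:
  fixes w :: "nat list"
  assumes "distinct w"
  shows "successively (\<lambda>a b. (a < b) = s) w \<longleftrightarrow> sorted_wrt (\<lambda>a b. if s then a < b else b < a) w"
proof (cases s)
  case True
  then show ?thesis by (simp add: successively_conv_sorted_wrt)
next
  case False
  have "successively (\<lambda>a b. b \<le> a) w \<longleftrightarrow> sorted_wrt (\<lambda>a b. b \<le> a) w"
    by (rule successively_conv_sorted_wrt) (auto simp: transp_def)
  also have "\<dots> \<longleftrightarrow> sorted_wrt (\<lambda>a b. b < a) w"
    using assms by (induction w) (auto simp: order.strict_iff_order)
  finally show ?thesis
    using False by (simp add: not_less)
qed

lemma sorted_imp_zeros_append:
  assumes "sorted us"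
  shows "\<exists>d vs. us = replicate d 0 @ map Suc vs"
  using assms
proof (induction us)
  case (Cons x us)
  show ?case
  proof (cases x)
    case 0
    from Cons obtain d vs where "us = replicate d 0 @ map Suc vs" by auto
    with 0 have "x # us = replicate (Suc d) 0 @ map Suc vs" by simp
    then show ?thesis by blast
  next
    case (Suc y)
    \<comment> \<open>A nonzero first entry forces all entries to be positive: there are no leading
      zeros, and subtracting 1 loses nothing.\<close>
    have "x # us = replicate 0 0 @ map Suc (map (\<lambda>z. z - 1) (x # us))"
      using Cons.prems Suc by (auto simp: comp_def intro!: map_idI[symmetric])
    then show ?thesis by blast
  qed
qed simp

text \<open>The leading zeros form the block of the first sign \<open>s\<close>; lowering the
  remaining labels by one turns them into labels for \<open>A\<close>.\<close>

lemma sorting_words_append: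
  assumes "distinct w" "d \<le> length w" "length vs = length w - d"
  shows "replicate d 0 @ map Suc vs \<in> sorting_words (s # A) w \<longleftrightarrow>
    successively (\<lambda>a b. (a < b) = s) (take d w) \<and> vs \<in> sorting_words A (drop d w)"
proof -
  have z: "zip (replicate d 0 @ map Suc vs) w =
      map (\<lambda>x. (0, x)) (take d w) @ map (apfst Suc) (zip vs (drop d w))"
  proof -
    have "zip (replicate d 0) (take d w) = map (\<lambda>x. (0 :: nat, x)) (take d w)"
      using assms(2) by (simp add: zip_replicate1)
    then show ?thesis
      using assms by (simp add: zip_append1 zip_map1 apfst_def map_prod_def)
  qed
  have "successively (\<lambda>a b. (a < b) = s) (take d w) \<longleftrightarrow>
      sorted_wrt (\<lambda>a b. if s then a < b else b < a) (take d w)"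
    using assms(1) by (intro sorted_wrt_distinct_iff) simp
  moreover have "letter_less (s # A) (0, x) (0, y) \<longleftrightarrow> (if s then x < y else y < x)"
      "letter_less (s # A) (0, x) (apfst Suc p)"
      "letter_less (s # A) (apfst Suc p) (apfst Suc q) \<longleftrightarrow> letter_less A p q" for x y p q
    by (auto simp: letter_less_def)
  ultimately show ?thesis
    using assms unfolding sorting_words_def
    by (auto simp: z sorted_wrt_append sorted_wrt_map image_subset_iff)
qed

text \<open>Cutting off the letters labelled 0 matches the recursion of \<open>shelf\<close>: the
  label words with exactly \<open>d\<close> zeros give the summand \<open>d\<close> of the
  convolution.\<close>

lemma shelf_eq_card:
  assumes "distinct w"
  shows "shelf A w = of_nat (card (sorting_words A w))"
  using assms
proof (induction A arbitrary: w)
  case Nil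
  have "sorting_words [] w = (if w = [] then {[]} else {})"
    by (auto simp: sorting_words_def)
  then show ?case by simp
next
  case (Cons s A)
  define F where "F d = (\<lambda>vs. replicate d (0::nat) @ map Suc vs) `
    (if successively (\<lambda>a b. (a < b) = s) (take d w) then sorting_words A (drop d w) else {})" for d
  have "sorting_words (s # A) w = (\<Union>d\<in>{..length w}. F d)"
  proof (intro equalityI subsetI)
    fix us assume us: "us \<in> sorting_words (s # A) w"
    then have len: "length us = length w" by (simp add: sorting_words_def)
    have "sorted_wrt (\<lambda>x y. fst x \<le> fst y) (zip us w)"
      by (rule sorted_wrt_mono_rel[of _ "letter_less (s # A)"])
        (use us in \<open>auto simp: sorting_words_def letter_less_def\<close>)
    then have "sorted (map fst (zip us w))"
      by (simp add: sorted_map)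
    then have "sorted us" using len by simp
    then obtain d vs where uv: "us = replicate d 0 @ map Suc vs"
      using sorted_imp_zeros_append by blast
    then have "d \<le> length w" "length vs = length w - d" using len by auto
    with us uv sorting_words_append[OF Cons.prems, of d vs s A] have "us \<in> F d"
      by (auto simp: F_def)
    with \<open>d \<le> length w\<close> show "us \<in> (\<Union>d\<in>{..length w}. F d)" by blast
  next
    fix us assume "us \<in> (\<Union>d\<in>{..length w}. F d)"
    then obtain d vs where *: "d \<le> length w" "us = replicate d 0 @ map Suc vs"
        "successively (\<lambda>a b. (a < b) = s) (take d w)" "vs \<in> sorting_words A (drop d w)"
      by (auto simp: F_def split: if_splits)
    then have "length vs = length w - d" by (simp add: sorting_words_def)
    with * sorting_words_append[OF Cons.prems, of d vs s A]
    show "us \<in> sorting_words (s # A) w" by simp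
  qed
  moreover have "F d \<inter> F e = {}" if "d \<noteq> e" for d e
  proof -
    have "length (filter (\<lambda>x. x = 0) us) = d" if "us \<in> F d" for us d
      using that by (auto simp: F_def filter_map comp_def split: if_splits)
    with that show ?thesis by blast
  qed
  moreover have "finite (F d)" for d
    by (simp add: F_def finite_sorting_words)
  ultimately have "card (sorting_words (s # A) w) = (\<Sum>d\<le>length w. card (F d))"
    by (simp add: card_UN_disjoint)
  moreover have "of_nat (card (F d)) = mono_word s (take d w) * shelf A (drop d w)" for d
  proof -
    have "inj_on (\<lambda>vs. replicate d (0::nat) @ map Suc vs) X" for X
      by (auto simp: inj_on_def)
    then have "card (F d) =
        card (if successively (\<lambda>a b. (a < b) = s) (take d w) then sorting_words A (drop d w) else {})"
      unfolding F_def by (rule card_image)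
    then show ?thesis
      using Cons.IH[of "drop d w"] Cons.prems by (simp add: mono_word_def)
  qed
  ultimately show ?case by (simp add: conv_def)
qed

section \<open>Labellings of values and their sorting permutations\<close>

definition labellings :: "nat \<Rightarrow> nat \<Rightarrow> (nat \<Rightarrow> nat) set"
  where "labellings n k = {1..n} \<rightarrow>\<^sub>E {..<k}"

lemma finite_labellings: "finite (labellings n k)"
  by (simp add: labellings_def finite_PiE)

lemma restrict_labelling_eq:
  assumes "u \<in> labellings n k" "\<And>v. v \<in> {1..n} \<Longrightarrow> f v = u v"
  shows "(\<lambda>v\<in>{1..n}. f v) = u"
proof
  fix v
  show "(\<lambda>v\<in>{1..n}. f v) v = u v"
  proof (cases "v \<in> {1..n}")
    case False
    with assms(1) have "u v = undefined"
      unfolding labellings_def by (rule PiE_arb)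
    with False show ?thesis by (simp only: restrict_def if_False)
  qed (use assms(2) in \<open>simp only: restrict_def if_True\<close>)
qed

definition sorts :: "nat \<Rightarrow> bool list \<Rightarrow> (nat \<Rightarrow> nat) \<Rightarrow> (nat \<Rightarrow> nat) \<Rightarrow> bool"
  where "sorts n A u \<sigma> \<longleftrightarrow> \<sigma> permutes {1..n} \<and>
    (\<forall>i j. 1 \<le> i \<and> i < j \<and> j \<le> n \<longrightarrow> letter_less A (u (\<sigma> i), \<sigma> i) (u (\<sigma> j), \<sigma> j))"

text \<open>A word labels positions, a labelling labels values; composing with
  \<open>\<sigma>\<close> translates one into the other and preserves the sorting condition.\<close>

lemma card_sorting_words:
  assumes "\<sigma> permutes {1..n}"
  shows "card (sorting_words A (word n \<sigma>)) = card {u \<in> labellings n (length A). sorts n A u \<sigma>}"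
proof -
  define f where "f u = map (\<lambda>i. u (\<sigma> i)) [1..<Suc n]" for u :: "nat \<Rightarrow> nat"
  \<comment> \<open>The label of the value \<open>v\<close> sits at its position
    \<open>inv \<sigma> v\<close>; positions start at 1 and list indices at 0.\<close>
  define g where "g us = (\<lambda>v\<in>{1..n}. us ! (inv \<sigma> v - 1))" for us :: "nat list"
  have \<sigma>_in: "\<sigma> i \<in> {1..n} \<longleftrightarrow> i \<in> {1..n}" for i
    using permutes_in_image[OF assms] .
  have inv_in: "inv \<sigma> i \<in> {1..n} \<longleftrightarrow> i \<in> {1..n}" for i
    using permutes_in_image[OF permutes_inv[OF assms]] .
  have zip_f: "zip (f u) (word n \<sigma>) = map (\<lambda>i. (u (\<sigma> i), \<sigma> i)) [1..<Suc n]" for u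
    unfolding f_def word_def by (rule zip_map_map[THEN trans]) (simp add: zip_same_conv_map)
  have sorted_upt: "sorted_wrt P [1..<Suc n] \<longleftrightarrow> (\<forall>i j. 1 \<le> i \<and> i < j \<and> j \<le> n \<longrightarrow> P i j)" for P
  proof -
    have "sorted_wrt P [1..<Suc n] \<longleftrightarrow> (\<forall>i j. i < j \<longrightarrow> j < n \<longrightarrow> P (Suc i) (Suc j))"
      by (simp add: sorted_wrt_iff_nth_less del: upt_Suc)
    also have "\<dots> \<longleftrightarrow> (\<forall>i j. 1 \<le> i \<and> i < j \<and> j \<le> n \<longrightarrow> P i j)"
    proof (intro iffI allI impI; (elim conjE)?)
      fix i j assume *: "\<forall>i j. i < j \<longrightarrow> j < n \<longrightarrow> P (Suc i) (Suc j)" "1 \<le> i" "i < j" "j \<le> n"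
      then show "P i j"
        using *(1)[rule_format, of "i - 1" "j - 1"] by simp
    qed auto
    finally show ?thesis .
  qed
  have sorts_iff: "sorted_wrt (letter_less A) (zip (f u) (word n \<sigma>)) \<longleftrightarrow> sorts n A u \<sigma>" for u
    using assms by (simp only: zip_f sorted_wrt_map sorted_upt sorts_def simp_thms)
  have fg: "f (g us) = us" if "length us = n" for us
    using that by (intro nth_equalityI)
      (auto simp: f_def g_def permutes_inverses[OF assms] \<sigma>_in[simplified] simp del: upt_Suc)
  have gf: "g (f u) = u" if "u \<in> labellings n (length A)" for u
    unfolding g_def
  proof (rule restrict_labelling_eq[OF that])
    fix v assume "v \<in> {1..n}"
    then have "inv \<sigma> v \<in> {1..n}" using inv_in by blast
    then obtain i where i: "inv \<sigma> v = Suc i" "i < n"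
      by (cases "inv \<sigma> v") auto
    then have "\<sigma> (Suc i) = v"
      using permutes_inverses(1)[OF assms, of v] by simp
    with i show "f u ! (inv \<sigma> v - 1) = u v"
      by (simp add: f_def del: upt_Suc)
  qed
  have "bij_betw f {u \<in> labellings n (length A). sorts n A u \<sigma>} (sorting_words A (word n \<sigma>))"
  proof (rule bij_betw_byWitness[where f' = g])
    show "\<forall>u\<in>{u \<in> labellings n (length A). sorts n A u \<sigma>}. g (f u) = u"
      by (simp add: gf)
    show "\<forall>us\<in>sorting_words A (word n \<sigma>). f (g us) = us"
      using fg by (simp add: sorting_words_def)
    show "f ` {u \<in> labellings n (length A). sorts n A u \<sigma>} \<subseteq> sorting_words A (word n \<sigma>)"
    proof clarify
      fix u assume u: "u \<in> labellings n (length A)" "sorts n A u \<sigma>"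
      have "set (f u) \<subseteq> {..<length A}"
      proof -
        have "u (\<sigma> i) < length A" if "1 \<le> i" "i \<le> n" for i
          using u(1) \<sigma>_in[of i] that by (auto simp: labellings_def PiE_iff)
        then show ?thesis by (auto simp: f_def)
      qed
      moreover have "length (f u) = n" by (simp add: f_def)
      ultimately show "f u \<in> sorting_words A (word n \<sigma>)"
        using u(2) sorts_iff by (simp add: sorting_words_def)
    qed
    show "g ` sorting_words A (word n \<sigma>) \<subseteq> {u \<in> labellings n (length A). sorts n A u \<sigma>}"
    proof clarify
      fix us assume us: "us \<in> sorting_words A (word n \<sigma>)"
      then have len: "length us = n" by (simp add: sorting_words_def)
      have "us ! (inv \<sigma> v - 1) < length A" if "v \<in> {1..n}" for v
      proof -
        have "inv \<sigma> v - 1 < length us"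
          using that inv_in[of v] len by auto
        then have "us ! (inv \<sigma> v - 1) \<in> set us" by (rule nth_mem)
        with us show ?thesis by (auto simp: sorting_words_def)
      qed
      then have "g us \<in> labellings n (length A)"
        by (auto simp: g_def labellings_def)
      moreover have "sorts n A (g us) \<sigma>"
        using us sorts_iff[of "g us"] fg[OF len] by (simp add: sorting_words_def)
      ultimately show "g us \<in> labellings n (length A) \<and> sorts n A (g us) \<sigma>" by simp
    qed
  qed
  then show ?thesis by (simp add: bij_betw_same_card)
qed

text \<open>The rank \<open>\<rho>\<close> of a value is one more than the number of values below it
  in the order \<open>lt\<close>. Its inverse sorts, and every sorting \<open>\<sigma>\<close>
  satisfies \<open>\<rho> (\<sigma> i) = i\<close> because exactly the values at the positions
  before \<open>i\<close> are below \<open>\<sigma> i\<close>.\<close>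

lemma ex1_sorting_permutation:
  fixes lt :: "nat \<Rightarrow> nat \<Rightarrow> bool"
  assumes irrefl: "\<And>x. \<not> lt x x"
    and trans: "\<And>x y z. lt x y \<Longrightarrow> lt y z \<Longrightarrow> lt x z"
    and total: "\<And>x y. x \<noteq> y \<Longrightarrow> lt x y \<or> lt y x"
  shows "\<exists>!\<sigma>. \<sigma> permutes {1..n} \<and> (\<forall>i j. 1 \<le> i \<and> i < j \<and> j \<le> n \<longrightarrow> lt (\<sigma> i) (\<sigma> j))"
proof -
  define \<rho> where "\<rho> v = (if v \<in> {1..n} then Suc (card {x \<in> {1..n}. lt x v}) else v)" for v
  have mono: "\<rho> x < \<rho> y" if "x \<in> {1..n}" "y \<in> {1..n}" "lt x y" for x y
  proof -
    have "{z \<in> {1..n}. lt z x} \<subset> {z \<in> {1..n}. lt z y}"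
      using that irrefl trans by blast
    then have "card {z \<in> {1..n}. lt z x} < card {z \<in> {1..n}. lt z y}"
      by (intro psubset_card_mono) auto
    with that show ?thesis by (simp add: \<rho>_def)
  qed
  have inj: "inj_on \<rho> {1..n}"
    by (rule inj_onI) (metis mono total less_irrefl)
  have "\<rho> v \<in> {1..n}" if "v \<in> {1..n}" for v
  proof -
    have "{x \<in> {1..n}. lt x v} \<subset> {1..n}"
      using that irrefl by blast
    then have "card {x \<in> {1..n}. lt x v} < card {1..n}"
      by (intro psubset_card_mono) auto
    with that show ?thesis by (simp add: \<rho>_def)
  qed
  then have "\<rho> ` {1..n} = {1..n}"
    by (intro endo_inj_surj inj) auto
  with inj have \<rho>: "\<rho> permutes {1..n}"
    by (intro bij_imp_permutes) (auto simp: bij_betw_def \<rho>_def)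
  show ?thesis
  proof (rule ex1I)
    show "inv \<rho> permutes {1..n} \<and> (\<forall>i j. 1 \<le> i \<and> i < j \<and> j \<le> n \<longrightarrow> lt (inv \<rho> i) (inv \<rho> j))"
    proof (intro conjI permutes_inv[OF \<rho>] allI impI)
      fix i j assume ij: "1 \<le> i \<and> i < j \<and> j \<le> n"
      then have "inv \<rho> i \<in> {1..n}" "inv \<rho> j \<in> {1..n}"
        using permutes_in_image[OF permutes_inv[OF \<rho>]] by auto
      moreover have "inv \<rho> i \<noteq> inv \<rho> j"
        using ij permutes_inverses[OF \<rho>] by (metis less_irrefl)
      ultimately show "lt (inv \<rho> i) (inv \<rho> j)"
        using mono[of "inv \<rho> j" "inv \<rho> i"] total ij permutes_inverses[OF \<rho>]
        by (metis less_asym)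
    qed
  next
    fix \<sigma> assume \<sigma>: "\<sigma> permutes {1..n} \<and> (\<forall>i j. 1 \<le> i \<and> i < j \<and> j \<le> n \<longrightarrow> lt (\<sigma> i) (\<sigma> j))"
    then have p: "\<sigma> permutes {1..n}" by simp
    have "\<rho> (\<sigma> i) = i" for i
    proof (cases "i \<in> {1..n}")
      case True
      have "{x \<in> {1..n}. lt x (\<sigma> i)} = \<sigma> ` {1..<i}"
      proof (intro equalityI subsetI)
        fix x assume x: "x \<in> {x \<in> {1..n}. lt x (\<sigma> i)}"
        then obtain j where j: "x = \<sigma> j" "j \<in> {1..n}"
          using permutes_image[OF p] by (metis (no_types, lifting) imageE mem_Collect_eq)
        have "j < i"
        proof (rule ccontr)
          assume "\<not> j < i"
          then have "j = i \<or> i < j" by linarith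
          then have "j = i \<or> lt (\<sigma> i) (\<sigma> j)"
            using \<sigma> True j by auto
          then show False using x j irrefl trans by blast
        qed
        with j show "x \<in> \<sigma> ` {1..<i}" by simp
      next
        fix x assume "x \<in> \<sigma> ` {1..<i}"
        then obtain j where j: "x = \<sigma> j" "1 \<le> j" "j < i" by auto
        moreover have "\<sigma> j \<in> {1..n}"
          using permutes_in_image[OF p, of j] j True by simp
        ultimately show "x \<in> {x \<in> {1..n}. lt x (\<sigma> i)}" using \<sigma> True by simp
      qed
      moreover have "card (\<sigma> ` {1..<i}) = i - 1"
        by (simp add: card_image[OF inj_on_subset[OF permutes_inj[OF p]]])
      moreover have "\<sigma> i \<in> {1..n}" using permutes_in_image[OF p] True by blast
      ultimately show ?thesis using True by (simp add: \<rho>_def)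
    next
      case False
      then have "\<sigma> i = i" using p by (simp add: permutes_not_in)
      with False show ?thesis by (auto simp: \<rho>_def)
    qed
    then show "\<sigma> = inv \<rho>"
      using permutes_inverses[OF \<rho>] by (metis ext)
  qed
qed

definition sort_perm :: "nat \<Rightarrow> bool list \<Rightarrow> (nat \<Rightarrow> nat) \<Rightarrow> nat \<Rightarrow> nat"
  where "sort_perm n A u = (THE \<sigma>. sorts n A u \<sigma>)"

lemma sorts_iff_sort_perm: "sorts n A u \<sigma> \<longleftrightarrow> \<sigma> = sort_perm n A u"
proof -
  have "\<exists>!\<sigma>. sorts n A u \<sigma>"
    unfolding sorts_def
    by (rule ex1_sorting_permutation[where lt = "\<lambda>x y. letter_less A (u x, x) (u y, y)"])
      (auto simp: letter_less_def split: if_splits)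
  then show ?thesis
    unfolding sort_perm_def by (metis theI')
qed

lemma sort_perm_permutes: "sort_perm n A u permutes {1..n}"
  using sorts_iff_sort_perm[of n A u "sort_perm n A u"] unfolding sorts_def by blast

text \<open>Sorting gives one direction; the converse holds since the order on labelled values is
  irreflexive and asymmetric.\<close>

lemma sort_perm_less_iff:
  assumes "p \<in> {1..n}" "q \<in> {1..n}"
  shows "p < q \<longleftrightarrow> letter_less A (u (sort_perm n A u p), sort_perm n A u p)
    (u (sort_perm n A u q), sort_perm n A u q)"
proof -
  have *: "letter_less A (u (sort_perm n A u p), sort_perm n A u p)
    (u (sort_perm n A u q), sort_perm n A u q)" if "p < q" "p \<in> {1..n}" "q \<in> {1..n}" for p q
    using sorts_iff_sort_perm[of n A u "sort_perm n A u"] that by (auto simp: sorts_def)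
  show ?thesis
  proof
    assume l: "letter_less A (u (sort_perm n A u p), sort_perm n A u p)
      (u (sort_perm n A u q), sort_perm n A u q)"
    show "p < q"
    proof (rule ccontr)
      assume "\<not> p < q"
      then have "p = q \<or> q < p" by linarith
      then have "p = q \<or> letter_less A (u (sort_perm n A u q), sort_perm n A u q)
          (u (sort_perm n A u p), sort_perm n A u p)"
        using *[of q p] assms by blast
      with l show False
        by (metis letter_less_irrefl letter_less_asym)
    qed
  qed (use * assms in blast)
qed

text \<open>Each labelling has exactly one sorting permutation, so counting the labellings sorted by
  \<open>\<sigma>\<close> writes the element as the sum of the sorting permutations of all
  labellings.\<close>

lemma shelf_sum_eq:
  "shelf_sum n A \<sigma> = (\<Sum>u\<in>labellings n (length A). of_bool (\<sigma> = sort_perm n A u))"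
proof (cases "\<sigma> permutes {1..n}")
  case True
  have "distinct (word n \<sigma>)"
    unfolding word_def by (simp add: distinct_map inj_on_subset[OF permutes_inj[OF True]])
  then have "shelf_sum n A \<sigma> = of_nat (card {u \<in> labellings n (length A). \<sigma> = sort_perm n A u})"
    using True by (simp add: shelf_sum_def shelf_eq_card card_sorting_words sorts_iff_sort_perm)
  then show ?thesis
    by (simp add: sum.If_cases of_bool_def finite_labellings Int_def)
next
  case False
  then have "\<sigma> \<noteq> sort_perm n A u" for u using sort_perm_permutes by blast
  with False show ?thesis by (simp add: shelf_sum_def)
qed

text \<open>Reversing an alphabet and its signs reverses the order that it induces on labelled values.\<close>

definition comb :: "bool list \<Rightarrow> bool list \<Rightarrow> bool list"
  where "comb A B = concat (map (\<lambda>b. if b then A else rev (map Not A)) B)"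

lemma length_comb: "length (comb A B) = length B * length A"
  by (induction B) (auto simp: comb_def)

lemma nth_comb:
  assumes "b < length B" "r < length A"
  shows "comb A B ! (b * length A + r) = (if B ! b then A ! r else \<not> A ! (length A - 1 - r))"
  using assms
proof (induction B arbitrary: b)
  case (Cons c B)
  show ?case
  proof (cases b)
    case 0
    with Cons.prems show ?thesis by (simp add: comb_def nth_append rev_nth)
  next
    case (Suc b')
    have "comb A (c # B) ! (b * length A + r) = comb A B ! (b' * length A + r)"
      by (simp add: comb_def nth_append Suc)
    with Cons Suc show ?thesis by simp
  qed
qed simp

text \<open>The position of the letter \<open>r\<close> in a copy of an alphabet of size
  \<open>k\<close>, which is reversed when the sign \<open>s\<close> is negative.\<close>

definition flip :: "bool \<Rightarrow> nat \<Rightarrow> nat \<Rightarrow> nat"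
  where "flip s k r = (if s then r else k - 1 - r)"

lemma flip_less: "r < k \<Longrightarrow> flip s k r < k"
  by (auto simp: flip_def)

lemma flip_flip: "r < k \<Longrightarrow> flip s k (flip s k r) = r"
  by (auto simp: flip_def)

lemma nth_comb_flip:
  assumes "b < length B" "r < length A"
  shows "comb A B ! (b * length A + flip (B ! b) (length A) r) = (A ! r = B ! b)"
  using assms by (simp add: nth_comb flip_less) (simp add: flip_def)

text \<open>The pair of labels as a number in base \<open>k\<close>: the outer label
  \<open>w v\<close> is the leading digit, the inner label \<open>u v\<close> the last one, mirrored
  in negative blocks.\<close>

definition pair_labelling ::
    "nat \<Rightarrow> nat \<Rightarrow> bool list \<Rightarrow> (nat \<Rightarrow> nat) \<Rightarrow> (nat \<Rightarrow> nat) \<Rightarrow> nat \<Rightarrow> nat"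
  where "pair_labelling n k B u w = (\<lambda>v\<in>{1..n}. w v * k + flip (B ! w v) k (u v))"

text \<open>After sorting by \<open>u\<close>, comparing positions means comparing labelled values
  by \<open>A\<close>. The second sort, by \<open>w\<close> carried from values to positions, thus
  orders by the outer label and breaks ties by the order of \<open>A\<close>, or by its reverse
  where the outer sign is negative. This is the order of the combined alphabet on pairs of
  labels.\<close>

lemma sort_perm_comb:
  assumes u: "u \<in> labellings n (length A)" and w: "w \<in> labellings n (length B)"
  shows "sort_perm n A u \<circ> sort_perm n B (\<lambda>p\<in>{1..n}. w (sort_perm n A u p)) =
    sort_perm n (comb A B) (pair_labelling n (length A) B u w)"
proof -
  define k where "k = length A"
  define \<alpha> where "\<alpha> = sort_perm n A u"
  define w' where "w' = (\<lambda>p\<in>{1..n}. w (\<alpha> p))"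
  define \<beta> where "\<beta> = sort_perm n B w'"
  define h where "h = pair_labelling n k B u w"
  have \<alpha>: "\<alpha> permutes {1..n}" and \<beta>: "\<beta> permutes {1..n}"
    unfolding \<alpha>_def \<beta>_def by (rule sort_perm_permutes)+
  have "letter_less (comb A B) (h ((\<alpha> \<circ> \<beta>) i), (\<alpha> \<circ> \<beta>) i) (h ((\<alpha> \<circ> \<beta>) j), (\<alpha> \<circ> \<beta>) j)"
    if ij: "1 \<le> i" "i < j" "j \<le> n" for i j
  proof -
    define p q x y where "p = \<beta> i" "q = \<beta> j" "x = \<alpha> p" "y = \<alpha> q"
    note defs = this
    have pq: "p \<in> {1..n}" "q \<in> {1..n}"
      using permutes_in_image[OF \<beta>] ij by (auto simp: defs)
    then have xy: "x \<in> {1..n}" "y \<in> {1..n}"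
      using permutes_in_image[OF \<alpha>] by (auto simp: defs)
    have less: "letter_less B (w x, p) (w y, q)"
    proof -
      have "letter_less B (w' (\<beta> i), \<beta> i) (w' (\<beta> j), \<beta> j)"
        using sort_perm_less_iff[of i n j B w', folded \<beta>_def] ij by simp
      moreover have "w' (\<beta> i) = w x" "w' (\<beta> j) = w y"
        using pq by (simp_all add: w'_def defs)
      ultimately show ?thesis by (simp add: defs)
    qed
    have A: "p < q \<longleftrightarrow> letter_less A (u x, x) (u y, y)" "q < p \<longleftrightarrow> letter_less A (u y, y) (u x, x)"
      using sort_perm_less_iff[of p n q A u, folded \<alpha>_def] sort_perm_less_iff[of q n p A u, folded \<alpha>_def] pq
      unfolding defs(3,4) by blast+
    have bounds: "u x < k" "u y < k" "w x < length B" "w y < length B"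
      using u w xy by (auto simp: labellings_def PiE_iff k_def)
    have h: "h x = w x * k + flip (B ! w x) k (u x)" "h y = w y * k + flip (B ! w y) k (u y)"
      using xy by (simp_all add: h_def pair_labelling_def)
    have sgn: "comb A B ! h x \<longleftrightarrow> (A ! u x = B ! w x)"
      using nth_comb_flip[of "w x" B "u x" A] bounds by (simp add: h k_def)
    consider "w x < w y" | "w x = w y" "B ! w x" "p < q" | "w x = w y" "\<not> B ! w x" "q < p"
      using less by (auto simp: letter_less_def split: if_splits)
    then have "letter_less (comb A B) (h x, x) (h y, y)"
    proof cases
      case 1
      have "h x < w x * k + k"
        unfolding h using bounds flip_less by simp
      also have "\<dots> = Suc (w x) * k" by simp
      also have "\<dots> \<le> w y * k" using 1 by (intro mult_le_mono1) simp
      also have "\<dots> \<le> h y" unfolding h by simp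
      finally show ?thesis by (simp add: letter_less_def)
    next
      case 2
      with A(1) have "letter_less A (u x, x) (u y, y)" by simp
      with 2 show ?thesis
        using sgn h by (auto simp: letter_less_def flip_def split: if_splits)
    next
      \<comment> \<open>Mirroring reverses the inner labels and the negated signs reverse the ties
        among equal ones, so the whole order of \<open>A\<close> is reversed.\<close>
      case 3
      with A(2) have "letter_less A (u y, y) (u x, x)" by simp
      with 3 show ?thesis
        using sgn h bounds by (auto simp: letter_less_def flip_def split: if_splits)
    qed
    then show ?thesis by (simp add: defs)
  qed
  then have "sorts n (comb A B) h (\<alpha> \<circ> \<beta>)"
    unfolding sorts_def using permutes_compose[OF \<beta> \<alpha>] by blast
  then show ?thesis
    by (simp add: sorts_iff_sort_perm \<alpha>_def \<beta>_def h_def w'_def k_def)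
qed

text \<open>Both factors are sums over labellings, so the product runs over pairs
  \<open>(u, w)\<close>. Moving \<open>w\<close> from positions to values makes
  \<open>sort_perm_comb\<close> applicable, and the pairs correspond to labellings with
  \<open>l * k\<close> labels through their digits in base \<open>k\<close>.\<close>

lemma int_prod_shelf_sum:
  "int_prod n (shelf_sum n A) (shelf_sum n B) = shelf_sum n (comb A B)"
proof
  fix \<tau>
  define k l where "k = length A" "l = length B"
  note kl = this
  let ?S = "{\<sigma>. \<sigma> permutes {1..n}}"
  let ?a = "sort_perm n A" and ?b = "sort_perm n B"
  have fin: "finite ?S" by (rule finite_permutations) simp
  have "int_prod n (shelf_sum n A) (shelf_sum n B) \<tau> =
    (\<Sum>\<alpha>\<in>?S. \<Sum>\<beta>\<in>?S. \<Sum>u\<in>labellings n k. \<Sum>w\<in>labellings n l.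
      of_bool (\<alpha> = ?a u) * (of_bool (\<beta> = ?b w) * of_bool (\<tau> = \<alpha> \<circ> \<beta>)))"
    unfolding int_prod_def shelf_sum_eq kl
    by (intro sum.cong refl) (simp only: sum_product, simp only: sum_distrib_right mult.assoc)
  also have "\<dots> = (\<Sum>\<alpha>\<in>?S. \<Sum>u\<in>labellings n k. \<Sum>\<beta>\<in>?S. \<Sum>w\<in>labellings n l.
      of_bool (\<alpha> = ?a u) * (of_bool (\<beta> = ?b w) * of_bool (\<tau> = \<alpha> \<circ> \<beta>)))"
    by (rule sum.cong[OF refl], rule sum.swap)
  also have "\<dots> = (\<Sum>\<alpha>\<in>?S. \<Sum>u\<in>labellings n k. \<Sum>w\<in>labellings n l. \<Sum>\<beta>\<in>?S.
      of_bool (\<alpha> = ?a u) * (of_bool (\<beta> = ?b w) * of_bool (\<tau> = \<alpha> \<circ> \<beta>)))"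
    by (rule sum.cong[OF refl], rule sum.cong[OF refl], rule sum.swap)
  also have "\<dots> = (\<Sum>\<alpha>\<in>?S. \<Sum>u\<in>labellings n k. \<Sum>w\<in>labellings n l.
      of_bool (\<alpha> = ?a u) * of_bool (\<tau> = \<alpha> \<circ> ?b w))"
  proof (intro sum.cong refl)
    fix \<alpha> u w
    have "(\<Sum>\<beta>\<in>?S. of_bool (\<alpha> = ?a u) * (of_bool (\<beta> = ?b w) * of_bool (\<tau> = \<alpha> \<circ> \<beta>))) =
      (\<Sum>\<beta>\<in>?S. if \<beta> = ?b w then of_bool (\<alpha> = ?a u) * of_bool (\<tau> = \<alpha> \<circ> ?b w) else (0::rat))"
      by (intro sum.cong refl) auto
    also have "\<dots> = of_bool (\<alpha> = ?a u) * of_bool (\<tau> = \<alpha> \<circ> ?b w)"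
      using fin sort_perm_permutes[of n B w] by (simp only: sum.delta mem_Collect_eq if_True)
    finally show "(\<Sum>\<beta>\<in>?S. of_bool (\<alpha> = ?a u) * (of_bool (\<beta> = ?b w) * of_bool (\<tau> = \<alpha> \<circ> \<beta>))) =
      of_bool (\<alpha> = ?a u) * (of_bool (\<tau> = \<alpha> \<circ> ?b w) :: rat)" .
  qed
  also have "\<dots> = (\<Sum>u\<in>labellings n k. \<Sum>\<alpha>\<in>?S. \<Sum>w\<in>labellings n l.
      of_bool (\<alpha> = ?a u) * of_bool (\<tau> = \<alpha> \<circ> ?b w))"
    by (rule sum.swap)
  also have "\<dots> = (\<Sum>u\<in>labellings n k. \<Sum>w\<in>labellings n l. of_bool (\<tau> = ?a u \<circ> ?b w))"
  proof (rule sum.cong[OF refl])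
    fix u
    have "(\<Sum>\<alpha>\<in>?S. \<Sum>w\<in>labellings n l. of_bool (\<alpha> = ?a u) * of_bool (\<tau> = \<alpha> \<circ> ?b w)) =
      (\<Sum>\<alpha>\<in>?S. if \<alpha> = ?a u then \<Sum>w\<in>labellings n l. of_bool (\<tau> = ?a u \<circ> ?b w) else (0::rat))"
      by (intro sum.cong refl) auto
    also have "\<dots> = (\<Sum>w\<in>labellings n l. of_bool (\<tau> = ?a u \<circ> ?b w))"
      using fin sort_perm_permutes[of n A u] by (simp only: sum.delta mem_Collect_eq if_True)
    finally show "(\<Sum>\<alpha>\<in>?S. \<Sum>w\<in>labellings n l. of_bool (\<alpha> = ?a u) * of_bool (\<tau> = \<alpha> \<circ> ?b w)) =
      (\<Sum>w\<in>labellings n l. of_bool (\<tau> = ?a u \<circ> ?b w) :: rat)" .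
  qed
  also have "\<dots> = (\<Sum>u\<in>labellings n k. \<Sum>w\<in>labellings n l.
      of_bool (\<tau> = sort_perm n (comb A B) (pair_labelling n k B u w)))"
  proof (rule sum.cong[OF refl])
    fix u assume u: "u \<in> labellings n k"
    have a: "?a u permutes {1..n}" by (rule sort_perm_permutes)
    have in1: "?a u p \<in> {1..n} \<longleftrightarrow> p \<in> {1..n}" for p by (rule permutes_in_image[OF a])
    have in2: "inv (?a u) p \<in> {1..n} \<longleftrightarrow> p \<in> {1..n}" for p
      by (rule permutes_in_image[OF permutes_inv[OF a]])
    \<comment> \<open>For fixed \<open>u\<close>, composition with the permutation
      \<open>?a u\<close> is a bijection on the labellings \<open>w\<close>.\<close>
    have "(\<Sum>w\<in>labellings n l. of_bool (\<tau> = ?a u \<circ> ?b w)) =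
      (\<Sum>w\<in>labellings n l. of_bool (\<tau> = ?a u \<circ> ?b (\<lambda>p\<in>{1..n}. w (?a u p))) :: rat)"
    proof (rule sum.reindex_bij_witness[where i = "\<lambda>w. \<lambda>p\<in>{1..n}. w (?a u p)"
          and j = "\<lambda>w. \<lambda>p\<in>{1..n}. w (inv (?a u) p)"])
      fix w assume w: "w \<in> labellings n l"
      show 1: "(\<lambda>p\<in>{1..n}. (\<lambda>p\<in>{1..n}. w (inv (?a u) p)) (?a u p)) = w"
      proof (rule restrict_labelling_eq[OF w])
        fix p assume "p \<in> {1..n}"
        then have "?a u p \<in> {1..n}" using in1 by blast
        then show "(\<lambda>p\<in>{1..n}. w (inv (?a u) p)) (?a u p) = w p"
          by (simp only: restrict_apply if_True permutes_inverses[OF a])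
      qed
      show "(\<lambda>p\<in>{1..n}. (\<lambda>p\<in>{1..n}. w (?a u p)) (inv (?a u) p)) = w"
      proof (rule restrict_labelling_eq[OF w])
        fix p assume "p \<in> {1..n}"
        then have "inv (?a u) p \<in> {1..n}" using in2 by blast
        then show "(\<lambda>p\<in>{1..n}. w (?a u p)) (inv (?a u) p) = w p"
          by (simp only: restrict_apply if_True permutes_inverses[OF a])
      qed
      show "(\<lambda>p\<in>{1..n}. w (inv (?a u) p)) \<in> labellings n l"
        using w in2 unfolding labellings_def restrict_PiE_iff by (blast intro: PiE_mem)
      show "(\<lambda>p\<in>{1..n}. w (?a u p)) \<in> labellings n l"
        using w in1 unfolding labellings_def restrict_PiE_iff by (blast intro: PiE_mem)
      show "of_bool (\<tau> = ?a u \<circ> ?b (\<lambda>p\<in>{1..n}. (\<lambda>p\<in>{1..n}. w (inv (?a u) p)) (?a u p))) =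
        (of_bool (\<tau> = ?a u \<circ> ?b w) :: rat)"
        by (simp only: 1)
    qed
    also have "\<dots> = (\<Sum>w\<in>labellings n l.
        of_bool (\<tau> = sort_perm n (comb A B) (pair_labelling n k B u w)))"
      using u by (intro sum.cong refl) (simp only: sort_perm_comb kl)
    finally show "(\<Sum>w\<in>labellings n l. of_bool (\<tau> = ?a u \<circ> ?b w)) = (\<Sum>w\<in>labellings n l.
        of_bool (\<tau> = sort_perm n (comb A B) (pair_labelling n k B u w)) :: rat)" .
  qed
  also have "\<dots> = (\<Sum>(u, w)\<in>labellings n k \<times> labellings n l.
      of_bool (\<tau> = sort_perm n (comb A B) (pair_labelling n k B u w)))"
    by (rule sum.cartesian_product)
  also have "\<dots> = (\<Sum>h\<in>labellings n (l * k). of_bool (\<tau> = sort_perm n (comb A B) h))"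
  proof (rule sum.reindex_bij_witness[where
        i = "\<lambda>h. (\<lambda>v\<in>{1..n}. flip (B ! (h v div k)) k (h v mod k), \<lambda>v\<in>{1..n}. h v div k)"
        and j = "\<lambda>(u, w). pair_labelling n k B u w"])
    fix x assume "x \<in> labellings n k \<times> labellings n l"
    then obtain u w where x: "x = (u, w)" and u: "u \<in> labellings n k" and w: "w \<in> labellings n l"
      by auto
    have b: "u v < k" "w v < l" if "v \<in> {1..n}" for v
      using u w that by (auto simp: labellings_def PiE_iff)
    have h: "pair_labelling n k B u w v div k = w v"
      "pair_labelling n k B u w v mod k = flip (B ! w v) k (u v)" if "v \<in> {1..n}" for v
      using that flip_less[OF b(1)[OF that], of "B ! w v"] by (auto simp: pair_labelling_def)
    have "(\<lambda>v\<in>{1..n}. pair_labelling n k B u w v div k) = w"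
      by (rule restrict_labelling_eq[OF w]) (rule h)
    moreover have "(\<lambda>v\<in>{1..n}. flip (B ! (pair_labelling n k B u w v div k)) k
        (pair_labelling n k B u w v mod k)) = u"
      by (rule restrict_labelling_eq[OF u]) (simp only: h flip_flip b)
    ultimately show "(\<lambda>h. (\<lambda>v\<in>{1..n}. flip (B ! (h v div k)) k (h v mod k), \<lambda>v\<in>{1..n}. h v div k))
        (case x of (u, w) \<Rightarrow> pair_labelling n k B u w) = x"
      by (simp add: x)
    have "w v * k + flip (B ! w v) k (u v) < l * k" if "v \<in> {1..n}" for v
    proof -
      have "w v * k + flip (B ! w v) k (u v) < Suc (w v) * k"
        using flip_less[OF b(1)[OF that], of "B ! w v"] by simp
      also have "\<dots> \<le> l * k" using b(2)[OF that] by (intro mult_le_mono1) simp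
      finally show ?thesis .
    qed
    then show "(case x of (u, w) \<Rightarrow> pair_labelling n k B u w) \<in> labellings n (l * k)"
      by (auto simp: x pair_labelling_def labellings_def)
    show "of_bool (\<tau> = sort_perm n (comb A B) (case x of (u, w) \<Rightarrow> pair_labelling n k B u w)) =
      (case x of (u, w) \<Rightarrow> (of_bool (\<tau> = sort_perm n (comb A B) (pair_labelling n k B u w)) :: rat))"
      by (simp add: x)
  next
    fix h assume h: "h \<in> labellings n (l * k)"
    have b: "h v div k < l" "h v mod k < k" if "v \<in> {1..n}" for v
    proof -
      have "h v < l * k" using h that by (auto simp: labellings_def PiE_iff)
      then show "h v div k < l" by (simp add: less_mult_imp_div_less)
      from \<open>h v < l * k\<close> have "k > 0" by (cases k) auto
      then show "h v mod k < k" by simp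
    qed
    show "(case (\<lambda>v\<in>{1..n}. flip (B ! (h v div k)) k (h v mod k), \<lambda>v\<in>{1..n}. h v div k) of
        (u, w) \<Rightarrow> pair_labelling n k B u w) = h"
      unfolding prod.case pair_labelling_def
    proof (rule restrict_labelling_eq[OF h])
      fix v assume v: "v \<in> {1..n}"
      then show "(\<lambda>v\<in>{1..n}. h v div k) v * k + flip (B ! (\<lambda>v\<in>{1..n}. h v div k) v) k
          ((\<lambda>v\<in>{1..n}. flip (B ! (h v div k)) k (h v mod k)) v) = h v"
        by (simp only: restrict_apply if_True flip_flip b div_mult_mod_eq)
    qed
    show "(\<lambda>v\<in>{1..n}. flip (B ! (h v div k)) k (h v mod k), \<lambda>v\<in>{1..n}. h v div k) \<in>
        labellings n k \<times> labellings n l"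
      using b by (auto simp: labellings_def intro!: flip_less)
  qed
  also have "\<dots> = shelf_sum n (comb A B) \<tau>"
    by (simp add: shelf_sum_eq length_comb kl)
  finally show "int_prod n (shelf_sum n A) (shelf_sum n B) \<tau> = shelf_sum n (comb A B) \<tau>" .
qed

section \<open>Products of alternating sign words\<close>

lemma alt_add: "alt (k + l) s = alt k s @ alt l (if even k then s else \<not> s)"
  by (induction k arbitrary: s) auto

text \<open>A nonempty reversed word starts with the former last sign, which is
  \<open>\<not> s\<close> for even and \<open>s\<close> for odd length; negation then yields
  \<open>s\<close> or \<open>\<not> s\<close>.\<close>

lemma rev_map_Not_alt: "rev (map Not (alt k s)) = alt k (if even k then s else \<not> s)"
proof (induction k arbitrary: s)
  case (Suc k)
  define t where "t = (if even k then \<not> s else s)"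
  have "alt (Suc k) t = alt k t @ [\<not> s]"
    using alt_add[of k 1 t] by (simp add: t_def split: if_splits)
  then show ?case using Suc[of "\<not> s"] by (simp add: t_def split: if_splits)
qed simp

text \<open>For even positive \<open>k\<close> every block equals \<open>alt k s\<close> and ends in
  \<open>\<not> s\<close>. For odd \<open>k\<close> a block begins and ends with the same sign,
  which the outer alternation flips from block to block. In both cases the signs alternate across
  the seams.\<close>

lemma comb_alt: "comb (alt k s) (alt l t) = alt (k * l) (if even k then s else s = t)"
proof (induction l arbitrary: t)
  case (Suc l)
  have "comb (alt k s) (alt (Suc l) t) =
      (if t then alt k s else rev (map Not (alt k s))) @ comb (alt k s) (alt l (\<not> t))"
    by (simp add: comb_def)
  also have "\<dots> = alt k (if even k then s else s = t) @ alt (k * l) (if even k then s else s = (\<not> t))"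
    unfolding Suc rev_map_Not_alt by auto
  also have "\<dots> = alt (k * Suc l) (if even k then s else s = t)"
    by (auto simp: alt_add)
  finally show ?case .
qed (simp add: comb_def)

definition Vs :: "nat \<Rightarrow> bool \<Rightarrow> nat \<Rightarrow> (nat \<Rightarrow> nat) \<Rightarrow> rat"
  where "Vs n s k = shelf_sum n (alt k s)"

lemma int_prod_Vs: "int_prod n (Vs n s k) (Vs n t l) = Vs n (if even k then s else s = t) (k * l)"
  by (simp add: Vs_def int_prod_shelf_sum comb_alt)

subsection \<open>Runs and peaks\<close>

definition turns :: "nat \<Rightarrow> nat \<Rightarrow> (nat \<Rightarrow> nat) \<Rightarrow> nat set"
  where "turns a b \<sigma> = {i. a < i \<and> i < b \<and> (\<sigma> (i - 1) < \<sigma> i) \<noteq> (\<sigma> i < \<sigma> (Suc i))}"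

lemma finite_turns: "finite (turns a b \<sigma>)"
  by (rule finite_subset[of _ "{..b}"]) (auto simp: turns_def)

lemma monotone_on_steps:
  fixes \<sigma> :: "nat \<Rightarrow> nat"
  assumes "transp R"
  shows "monotone_on {i..j} (<) R \<sigma> \<longleftrightarrow> (\<forall>k\<in>{i..<j}. R (\<sigma> k) (\<sigma> (Suc k)))"
proof
  assume steps: "\<forall>k\<in>{i..<j}. R (\<sigma> k) (\<sigma> (Suc k))"
  have "R (\<sigma> x) (\<sigma> (Suc (x + d)))" if "i \<le> x" "Suc (x + d) \<le> j" for x d
    using that
  proof (induction d)
    case (Suc d)
    have "R (\<sigma> (Suc (x + d))) (\<sigma> (Suc (Suc (x + d))))"
      using steps Suc.prems by auto
    then show ?case
      using Suc transpD[OF assms] by simp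
  qed (use steps in auto)
  then show "monotone_on {i..j} (<) R \<sigma>"
    by (auto simp: monotone_on_def less_iff_Suc_add)
qed (auto simp: monotone_on_def)

text \<open>A single sign \<open>s\<close> for all steps covers ascending and descending at once;
  injectivity excludes equal neighbours.\<close>

lemma monotone_between_iff:
  assumes "inj_on \<sigma> {a..b}" "a \<le> i" "j \<le> b"
  shows "monotone_between \<sigma> i j \<longleftrightarrow> (\<exists>s. \<forall>k\<in>{i..<j}. (\<sigma> k < \<sigma> (Suc k)) = s)"
proof -
  have ne: "\<sigma> k \<noteq> \<sigma> (Suc k)" if "k \<in> {i..<j}" for k
    using inj_onD[OF assms(1), of k "Suc k"] that assms(2,3) by auto
  have 1: "strict_mono_on {i..j} \<sigma> \<longleftrightarrow> (\<forall>k\<in>{i..<j}. (\<sigma> k < \<sigma> (Suc k)) = True)"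
    by (subst monotone_on_steps) auto
  have "strict_antimono_on {i..j} \<sigma> \<longleftrightarrow> (\<forall>k\<in>{i..<j}. \<sigma> (Suc k) < \<sigma> k)"
    by (subst monotone_on_steps) (auto simp: transp_def)
  also have "\<dots> \<longleftrightarrow> (\<forall>k\<in>{i..<j}. (\<sigma> k < \<sigma> (Suc k)) = False)"
    by (intro ball_cong refl) (metis ne linorder_neqE_nat less_asym)
  finally have 2: "strict_antimono_on {i..j} \<sigma> \<longleftrightarrow> (\<forall>k\<in>{i..<j}. (\<sigma> k < \<sigma> (Suc k)) = False)" .
  show ?thesis
    unfolding monotone_between_def 1 2 by (metis (full_types))
qed

text \<open>A one-point interval is monotone but can be enlarged by a neighbour, since the word has
  at least two letters.\<close>

lemma runs_nondegenerate:
  assumes "inj_on \<sigma> {a..b}" "a < b" "(i, j) \<in> runs a b \<sigma>"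
  shows "i < j"
proof (rule ccontr)
  assume "\<not> i < j"
  with assms(3) have ij: "i = j" "a \<le> i" "i \<le> b"
    and max: "\<And>i' j'. a \<le> i' \<Longrightarrow> i' \<le> i \<Longrightarrow> j \<le> j' \<Longrightarrow> j' \<le> b \<Longrightarrow> monotone_between \<sigma> i' j' \<Longrightarrow> i' = i \<and> j' = j"
    by (auto simp: runs_def)
  show False
  proof (cases "i < b")
    case True
    then have "monotone_between \<sigma> i (Suc i)"
      using ij by (subst monotone_between_iff[OF assms(1)]) auto
    with max[of i "Suc i"] ij True show False by auto
  next
    case False
    with ij assms(2) obtain m where m: "i = Suc m" "a \<le> m"
      by (cases i) auto
    then have "monotone_between \<sigma> m (Suc m)"
      using ij by (subst monotone_between_iff[OF assms(1)]) auto
    with max[of m "Suc m"] ij m show False by auto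
  qed
qed

text \<open>A run that starts after \<open>a\<close> and not at a turn could be extended to the
  left. Conversely, the longest monotone interval starting at \<open>a\<close> or at a turn cannot
  be extended on either side.\<close>

lemma fst_image_runs:
  assumes inj: "inj_on \<sigma> {a..b}" and ab: "a < b"
  shows "fst ` runs a b \<sigma> = insert a (turns a b \<sigma>)"
proof (intro equalityI subsetI)
  fix i assume "i \<in> fst ` runs a b \<sigma>"
  then obtain j where j: "(i, j) \<in> runs a b \<sigma>" by auto
  then have ij: "a \<le> i" "i < j" "j \<le> b" "monotone_between \<sigma> i j"
    and max: "\<And>i' j'. a \<le> i' \<Longrightarrow> i' \<le> i \<Longrightarrow> j \<le> j' \<Longrightarrow> j' \<le> b \<Longrightarrow> monotone_between \<sigma> i' j' \<Longrightarrow> i' = i \<and> j' = j"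
    using runs_nondegenerate[OF inj ab j] by (auto simp: runs_def)
  show "i \<in> insert a (turns a b \<sigma>)"
  proof (rule ccontr)
    assume not: "i \<notin> insert a (turns a b \<sigma>)"
    then have "a < i" "(\<sigma> (i - 1) < \<sigma> i) = (\<sigma> i < \<sigma> (Suc i))"
      using ij by (auto simp: turns_def)
    moreover obtain s where "\<forall>k\<in>{i..<j}. (\<sigma> k < \<sigma> (Suc k)) = s"
      using ij monotone_between_iff[OF inj] by auto
    moreover have "{i - 1..<j} = insert (i - 1) {i..<j}"
      using \<open>a < i\<close> ij by auto
    ultimately have "\<forall>k\<in>{i - 1..<j}. (\<sigma> k < \<sigma> (Suc k)) = s"
      using ij by auto
    then have "monotone_between \<sigma> (i - 1) j"
      using ij \<open>a < i\<close> monotone_between_iff[OF inj, of "i - 1" j] by auto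
    moreover have "a \<le> i - 1" "i - 1 \<le> i" "i - 1 \<noteq> i"
      using \<open>a < i\<close> by linarith+
    ultimately show False using max[of "i - 1" j] ij by blast
  qed
next
  fix i assume i: "i \<in> insert a (turns a b \<sigma>)"
  then have ib: "a \<le> i" "i < b" using ab by (auto simp: turns_def)
  define X where "X = {j. i \<le> j \<and> j \<le> b \<and> monotone_between \<sigma> i j}"
  have fin: "finite X" by (rule finite_subset[of _ "{..b}"]) (auto simp: X_def)
  have "monotone_between \<sigma> i (Suc i)"
    using ib by (subst monotone_between_iff[OF inj]) auto
  then have Suc_i: "Suc i \<in> X" using ib by (auto simp: X_def)
  define j where "j = Max X"
  have jX: "j \<in> X" unfolding j_def using fin Suc_i by (intro Max_in) auto
  have j_ge: "Suc i \<le> j" unfolding j_def using fin Suc_i by (rule Max_ge)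
  have "(i, j) \<in> runs a b \<sigma>"
    unfolding runs_def mem_Collect_eq prod.case
  proof (intro conjI allI impI; (elim conjE)?)
    fix i' j' assume *: "a \<le> i'" "i' \<le> i" "j \<le> j'" "j' \<le> b" "monotone_between \<sigma> i' j'"
    then obtain s where s: "\<forall>k\<in>{i'..<j'}. (\<sigma> k < \<sigma> (Suc k)) = s"
      using monotone_between_iff[OF inj, of i' j'] by auto
    then have "monotone_between \<sigma> i j'"
      using * ib monotone_between_iff[OF inj, of i j'] by auto
    with * jX have "j' \<in> X" by (auto simp: X_def)
    then have "j' \<le> j" unfolding j_def using fin by (intro Max_ge)
    with * show "j' = j" by simp
    show "i' = i"
    proof (rule ccontr)
      assume "i' \<noteq> i"
      with * have "i' < i" by simp
      with i * have "(\<sigma> (i - 1) < \<sigma> i) \<noteq> (\<sigma> i < \<sigma> (Suc i))" by (auto simp: turns_def)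
      moreover have "i - 1 \<in> {i'..<j'}" "i \<in> {i'..<j'}" "Suc (i - 1) = i"
        using \<open>i' < i\<close> j_ge * by auto
      ultimately show False using s by metis
    qed
  qed (use ib jX in \<open>auto simp: X_def\<close>)
  then show "i \<in> fst ` runs a b \<sigma>" by force
qed

text \<open>By maximality a run is determined by its starting position.\<close>

lemma card_runs:
  assumes "inj_on \<sigma> {a..b}" "a < b"
  shows "card (runs a b \<sigma>) = Suc (card (turns a b \<sigma>))"
proof -
  have "inj_on fst (runs a b \<sigma>)"
  proof (rule inj_onI, clarsimp)
    have *: "j = j'" if "(i, j) \<in> runs a b \<sigma>" "(i, j') \<in> runs a b \<sigma>" "j \<le> j'" for i j j'
      using that by (auto simp: runs_def)
    fix i j j' assume "(i, j) \<in> runs a b \<sigma>" "(i, j') \<in> runs a b \<sigma>"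
    then show "j = j'"
      using *[of i j j'] *[of i j' j] by linarith
  qed
  then have "card (runs a b \<sigma>) = card (insert a (turns a b \<sigma>))"
    using card_image fst_image_runs[OF assms] by metis
  moreover have "a \<notin> turns a b \<sigma>" by (simp add: turns_def)
  ultimately show ?thesis by (simp add: finite_turns)
qed

abbreviation seg :: "(nat \<Rightarrow> nat) \<Rightarrow> nat \<Rightarrow> nat \<Rightarrow> nat list"
  where "seg \<sigma> a b \<equiv> map \<sigma> [a..<Suc b]"

lemma changes_seg:
  assumes "a < b"
  shows "changes s (seg \<sigma> a b) =
    (if (\<sigma> a < \<sigma> (Suc a)) = s then 0 else 1) + changes (\<sigma> a < \<sigma> (Suc a)) (seg \<sigma> (Suc a) b)"
proof -
  have "[a..<Suc b] = a # Suc a # [Suc (Suc a)..<Suc b]" "[Suc a..<Suc b] = Suc a # [Suc (Suc a)..<Suc b]"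
    using assms by (simp_all add: upt_conv_Cons del: upt_Suc)
  then show ?thesis by (simp del: upt_Suc)
qed

text \<open>With the direction of the first step as initial sign no change is counted at the start,
  and every later change is a turn.\<close>

lemma changes_seg_eq_card_turns:
  assumes "a < b"
  shows "changes (\<sigma> a < \<sigma> (Suc a)) (seg \<sigma> a b) = card (turns a b \<sigma>)"
  using assms
proof (induction "b - a" arbitrary: a)
  case (Suc d)
  show ?case
  proof (cases "Suc a = b")
    case True
    then have "turns a b \<sigma> = {}" by (auto simp: turns_def)
    with True show ?thesis using changes_seg[OF Suc.prems, of _ \<sigma>] by simp
  next
    case False
    with Suc.prems have lt: "Suc a < b" by simp
    let ?t = "(\<sigma> a < \<sigma> (Suc a)) \<noteq> (\<sigma> (Suc a) < \<sigma> (Suc (Suc a)))"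
    have "turns a b \<sigma> = (if ?t then {Suc a} else {}) \<union> turns (Suc a) b \<sigma>"
    proof (intro set_eqI)
      fix x
      show "x \<in> turns a b \<sigma> \<longleftrightarrow> x \<in> (if ?t then {Suc a} else {}) \<union> turns (Suc a) b \<sigma>"
        using lt by (cases "x = Suc a") (auto simp: turns_def)
    qed
    moreover have "Suc a \<notin> turns (Suc a) b \<sigma>" by (simp add: turns_def)
    ultimately have "card (turns a b \<sigma>) = (if ?t then 1 else 0) + card (turns (Suc a) b \<sigma>)"
      by (simp add: finite_turns)
    moreover have "changes (\<sigma> a < \<sigma> (Suc a)) (seg \<sigma> a b) =
        (if ?t then 1 else 0) + changes (\<sigma> (Suc a) < \<sigma> (Suc (Suc a))) (seg \<sigma> (Suc a) b)"
      unfolding changes_seg[OF Suc.prems] changes_seg[OF lt] by auto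
    moreover have "changes (\<sigma> (Suc a) < \<sigma> (Suc (Suc a))) (seg \<sigma> (Suc a) b) = card (turns (Suc a) b \<sigma>)"
      using Suc.hyps lt by auto
    ultimately show ?thesis by simp
  qed
qed simp

section \<open>Peaks and sign changes\<close>

definition inner_peaks :: "nat \<Rightarrow> nat \<Rightarrow> (nat \<Rightarrow> nat) \<Rightarrow> nat set"
  where "inner_peaks a b \<sigma> = {i. a < i \<and> i < b \<and> \<sigma> (i - 1) < \<sigma> i \<and> \<not> \<sigma> i < \<sigma> (Suc i)}"

text \<open>A peak is a change from ascent to descent, and changes alternate between the two kinds.
  After an initial sign \<open>False\<close> every second change is a peak. After
  \<open>True\<close> it is the first, third and so on, where a descent right at the start is a
  change without being a peak. Deleting the first letter can switch the initial sign, so both counts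
  are proved together.\<close>

lemma card_inner_peaks:
  assumes "a \<le> b"
  shows "card (inner_peaks a b \<sigma>) = changes False (seg \<sigma> a b) div 2"
    and "card (inner_peaks a b \<sigma>) + of_bool (a < b \<and> \<not> \<sigma> a < \<sigma> (Suc a)) =
      Suc (changes True (seg \<sigma> a b)) div 2"
proof -
  have "card (inner_peaks a b \<sigma>) = changes False (seg \<sigma> a b) div 2 \<and>
    card (inner_peaks a b \<sigma>) + of_bool (a < b \<and> \<not> \<sigma> a < \<sigma> (Suc a)) =
      Suc (changes True (seg \<sigma> a b)) div 2"
    using assms
  proof (induction "b - a" arbitrary: a)
    case 0
    then have "a = b" by simp
    moreover have "inner_peaks b b \<sigma> = {}" by (auto simp: inner_peaks_def)
    ultimately show ?case by simp
  next
    case (Suc d)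
    then have lt: "a < b" by simp
    let ?t = "\<sigma> a < \<sigma> (Suc a) \<and> Suc a < b \<and> \<not> \<sigma> (Suc a) < \<sigma> (Suc (Suc a))"
    have "inner_peaks a b \<sigma> = (if ?t then {Suc a} else {}) \<union> inner_peaks (Suc a) b \<sigma>"
    proof (intro set_eqI)
      fix x
      show "x \<in> inner_peaks a b \<sigma> \<longleftrightarrow> x \<in> (if ?t then {Suc a} else {}) \<union> inner_peaks (Suc a) b \<sigma>"
        using lt by (cases "x = Suc a") (auto simp: inner_peaks_def)
    qed
    moreover have "Suc a \<notin> inner_peaks (Suc a) b \<sigma>" by (simp add: inner_peaks_def)
    moreover have "finite (inner_peaks (Suc a) b \<sigma>)"
      by (rule finite_subset[of _ "{..b}"]) (auto simp: inner_peaks_def)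
    ultimately have c: "card (inner_peaks a b \<sigma>) = (if ?t then 1 else 0) + card (inner_peaks (Suc a) b \<sigma>)"
      by simp
    have "d = b - Suc a" "Suc a \<le> b" using Suc.hyps(2) lt by auto
    note IH = Suc.hyps(1)[OF this]
    show ?case
      using IH lt c unfolding changes_seg[OF lt] by (cases "\<sigma> a < \<sigma> (Suc a)") auto
  qed
  then show "card (inner_peaks a b \<sigma>) = changes False (seg \<sigma> a b) div 2"
    and "card (inner_peaks a b \<sigma>) + of_bool (a < b \<and> \<not> \<sigma> a < \<sigma> (Suc a)) =
      Suc (changes True (seg \<sigma> a b)) div 2" by auto
qed

section \<open>Statistics of a permutation as numbers of sign changes\<close>

context
  fixes n :: nat and \<sigma> :: "nat \<Rightarrow> nat"
  assumes n: "n \<ge> 2" and perm: "\<sigma> permutes {1..n}"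
begin

lemma perm_0: "\<sigma> 0 = 0" "\<sigma> 0 < \<sigma> (Suc 0)"
proof -
  show "\<sigma> 0 = 0" using permutes_not_in[OF perm, of 0] by simp
  have "\<sigma> (Suc 0) \<noteq> \<sigma> 0" using permutes_inj[OF perm] by (metis injD n_not_Suc_n)
  with \<open>\<sigma> 0 = 0\<close> show "\<sigma> 0 < \<sigma> (Suc 0)" by simp
qed

lemma perm_inj_on: "inj_on \<sigma> X"
  using inj_on_subset[OF permutes_inj[OF perm]] by auto

lemma run_eq_changes: "run n \<sigma> = Suc (changes (\<sigma> 1 < \<sigma> 2) (word n \<sigma>))"
  using n card_runs[OF perm_inj_on, of 1 n] changes_seg_eq_card_turns[of 1 n \<sigma>]
  by (simp add: run_def word_def numeral_2_eq_2 del: upt_Suc)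

text \<open>An initial sign that disagrees with the first step adds one change to the
  \<open>run n \<sigma> - 1\<close> turns.\<close>

lemma changes_eq_run: "changes s (word n \<sigma>) = (if (\<sigma> 1 < \<sigma> 2) = s then run n \<sigma> - 1 else run n \<sigma>)"
proof -
  define t where "t = (\<sigma> 1 < \<sigma> 2)"
  have seg: "changes s' (word n \<sigma>) = (if t = s' then 0 else 1) + changes t (seg \<sigma> 2 n)" for s'
    using n changes_seg[of 1 n s' \<sigma>] by (simp add: t_def word_def numeral_2_eq_2 del: upt_Suc)
  show ?thesis
    unfolding run_eq_changes t_def[symmetric] seg by simp
qed

lemma run_bounds: "1 \<le> run n \<sigma>" "run n \<sigma> < n"
proof -
  show "1 \<le> run n \<sigma>" by (simp add: run_eq_changes)
  \<comment> \<open>With the disagreeing initial sign the number of changes equals the number of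
    runs, so the bound on changes carries over.\<close>
  have "changes (\<not> \<sigma> 1 < \<sigma> 2) (word n \<sigma>) < n"
    using changes_less[of "word n \<sigma>"] n by (metis length_word length_0_conv not_numeral_le_zero)
  then show "run n \<sigma> < n" by (simp add: changes_eq_run split: if_splits)
qed

text \<open>The step from \<open>\<sigma> 0 = 0\<close> is always an ascent, so a positive initial
  sign stands in for it.\<close>

lemma left_run_eq_changes: "left_run n \<sigma> = Suc (changes True (word n \<sigma>))"
  using n card_runs[OF perm_inj_on, of 0 n] changes_seg_eq_card_turns[of 0 n \<sigma>] changes_seg[of 0 n True \<sigma>] perm_0
  by (simp add: left_run_def word_def del: upt_Suc)

lemma ex_first_run: "\<exists>j>1. (1, j) \<in> runs 1 n \<sigma>"
proof -
  have "1 \<in> fst ` runs 1 n \<sigma>"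
    using fst_image_runs[OF perm_inj_on, of 1 n] n by simp
  then obtain j where "(1, j) \<in> runs 1 n \<sigma>" by auto
  moreover from this have "1 < j"
    using runs_nondegenerate[OF perm_inj_on, of 1 n 1 j] n by simp
  ultimately show ?thesis by blast
qed

lemma first_run_ascending_iff: "first_run_ascending n \<sigma> \<longleftrightarrow> \<sigma> 1 < \<sigma> 2"
proof
  assume "first_run_ascending n \<sigma>"
  then obtain j where j: "(1, j) \<in> runs 1 n \<sigma>" "strict_mono_on {1..j} \<sigma>"
    by (auto simp: first_run_ascending_def)
  then have "1 < j" using runs_nondegenerate[OF perm_inj_on, of 1 n 1 j] n by simp
  with j show "\<sigma> 1 < \<sigma> 2" by (auto simp: monotone_on_def)
next
  assume lt: "\<sigma> 1 < \<sigma> 2"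
  obtain j where j: "j > 1" "(1, j) \<in> runs 1 n \<sigma>" using ex_first_run by blast
  have "\<not> strict_antimono_on {1..j} \<sigma>"
  proof
    assume "strict_antimono_on {1..j} \<sigma>"
    with j have "\<sigma> 2 < \<sigma> 1" by (auto simp: monotone_on_def)
    with lt show False by simp
  qed
  moreover have "monotone_between \<sigma> 1 j"
    using j(2) by (simp add: runs_def)
  ultimately show "first_run_ascending n \<sigma>"
    using j(2) unfolding first_run_ascending_def monotone_between_def by blast
qed

lemma first_run_descending_iff: "first_run_descending n \<sigma> \<longleftrightarrow> \<not> \<sigma> 1 < \<sigma> 2"
proof
  assume "first_run_descending n \<sigma>"
  then obtain j where j: "(1, j) \<in> runs 1 n \<sigma>" "strict_antimono_on {1..j} \<sigma>"
    by (auto simp: first_run_descending_def)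
  then have "1 < j" using runs_nondegenerate[OF perm_inj_on, of 1 n 1 j] n by simp
  with j have "\<sigma> 2 < \<sigma> 1" by (auto simp: monotone_on_def)
  then show "\<not> \<sigma> 1 < \<sigma> 2" by simp
next
  assume lt: "\<not> \<sigma> 1 < \<sigma> 2"
  obtain j where j: "j > 1" "(1, j) \<in> runs 1 n \<sigma>" using ex_first_run by blast
  have "\<not> strict_mono_on {1..j} \<sigma>"
  proof
    assume "strict_mono_on {1..j} \<sigma>"
    with j have "\<sigma> 1 < \<sigma> 2" by (auto simp: monotone_on_def)
    with lt show False by simp
  qed
  moreover have "monotone_between \<sigma> 1 j"
    using j(2) by (simp add: runs_def)
  ultimately show "first_run_descending n \<sigma>"
    using j(2) unfolding first_run_descending_def monotone_between_def by blast
qed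

lemma perm_step: "\<sigma> (Suc i) < \<sigma> i \<longleftrightarrow> \<not> \<sigma> i < \<sigma> (Suc i)"
  by (metis perm_inj_on inj_onD UNIV_I n_not_Suc_n linorder_neqE_nat less_asym)

lemma card_peaks: "card (peaks n \<sigma>) = changes False (word n \<sigma>) div 2"
proof -
  have "peaks n \<sigma> = inner_peaks 1 n \<sigma>"
    using n by (auto simp: peaks_def inner_peaks_def perm_step)
  then show ?thesis using n card_inner_peaks(1)[of 1 n \<sigma>] by (simp add: word_def)
qed

text \<open>Left peaks are inner peaks of the word with 0 in front; its first step is an ascent and
  accounts for the extra change after the initial sign \<open>False\<close>.\<close>

lemma card_left_peaks: "card (left_peaks n \<sigma>) = Suc (changes True (word n \<sigma>)) div 2"
proof -
  have "left_peaks n \<sigma> = inner_peaks 0 n \<sigma>"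
    using n by (auto simp: left_peaks_def inner_peaks_def perm_step)
  then show ?thesis
    using n card_inner_peaks(1)[of 0 n \<sigma>] changes_seg[of 0 n False \<sigma>] perm_0
    by (simp add: word_def del: upt_Suc)
qed

lemma Vs_eq_coef: "Vs n s k \<sigma> = coef n (changes s (word n \<sigma>)) k"
proof -
  have "word n \<sigma> \<noteq> []" using n by (metis length_word list.size(3) not_numeral_le_zero)
  then show ?thesis
    using perm by (simp add: Vs_def shelf_sum_def shelf_alt_eq_coef)
qed

lemma changes_word_less: "changes s (word n \<sigma>) < n"
  using changes_less[of "word n \<sigma>" s] n by (metis length_word length_0_conv not_numeral_le_zero)

end

subsection \<open>Spans\<close>

context
  fixes n :: nat and cls :: "(nat \<Rightarrow> nat) \<Rightarrow> 'i" and I J :: "'i set"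
    and A B :: "'i \<Rightarrow> (nat \<Rightarrow> nat) \<Rightarrow> rat" and q :: "'i \<Rightarrow> 'i \<Rightarrow> rat" and rk :: "'i \<Rightarrow> nat"
  assumes fin: "finite I" and IJ: "I \<subseteq> J"
    and cls: "\<And>\<sigma>. \<sigma> permutes {1..n} \<Longrightarrow> cls \<sigma> \<in> I"
    and B: "\<And>i \<sigma>. B i \<sigma> = of_bool (\<sigma> permutes {1..n} \<and> cls \<sigma> = i)"
    and A: "\<And>i \<sigma>. i \<in> J \<Longrightarrow> A i \<sigma> = (if \<sigma> permutes {1..n} then q i (cls \<sigma>) else 0)"
    and diag: "\<And>i. i \<in> I \<Longrightarrow> q i i \<noteq> 0"
    and upper: "\<And>i j. i \<in> I \<Longrightarrow> j \<in> I \<Longrightarrow> i \<noteq> j \<Longrightarrow> rk i \<le> rk j \<Longrightarrow> q i j = 0"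
begin

text \<open>\<open>A i\<close> takes the value \<open>q i j\<close> on the class \<open>j\<close>,
  whose indicator is \<open>B j\<close>; all classes that occur lie in \<open>I\<close>, even when
  \<open>i\<close> lies only in \<open>J\<close>.\<close>

lemma triangular_expansion:
  assumes "i \<in> J"
  shows "A i = (\<Sum>j\<in>I. qscale (q i j) (B j))"
proof
  fix \<sigma>
  have sum_apply: "(\<Sum>j\<in>S. f j) \<sigma> = (\<Sum>j\<in>S. f j \<sigma>)"
    for S :: "'i set" and f :: "'i \<Rightarrow> (nat \<Rightarrow> nat) \<Rightarrow> rat"
    by (induction S rule: infinite_finite_induct) auto
  have "(\<Sum>j\<in>I. qscale (q i j) (B j)) \<sigma> =
      (\<Sum>j\<in>I. if j = cls \<sigma> then (if \<sigma> permutes {1..n} then q i j else 0) else 0)"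
    unfolding sum_apply qscale_def B by (intro sum.cong refl) auto
  also have "\<dots> = A i \<sigma>"
    using fin cls A[OF assms] by (simp add: sum.delta)
  finally show "A i \<sigma> = (\<Sum>j\<in>I. qscale (q i j) (B j)) \<sigma>" by simp
qed

text \<open>Forward substitution along \<open>rk\<close>: besides \<open>i\<close> only classes of
  smaller rank occur in the expansion of \<open>A i\<close>, so \<open>B i\<close> is obtained on
  dividing by the diagonal entry.\<close>

lemma triangular_inverse:
  assumes "i \<in> I"
  shows "B i \<in> QV.span (A ` I)"
  using assms
proof (induction "rk i" arbitrary: i rule: less_induct)
  case less
  have "A i = qscale (q i i) (B i) + (\<Sum>j\<in>I - {i}. qscale (q i j) (B j))"
    using triangular_expansion[of i] less.prems IJ fin by (auto simp: sum.remove)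
  then have eq: "qscale (q i i) (B i) = A i - (\<Sum>j\<in>I - {i}. qscale (q i j) (B j))"
    by simp
  have "qscale (q i j) (B j) \<in> QV.span (A ` I)" if "j \<in> I - {i}" for j
  proof (cases "rk j < rk i")
    case True
    then show ?thesis using less.hyps that by (auto intro: QV.span_scale)
  next
    case False
    then have "q i j = 0" using upper less.prems that by auto
    then show ?thesis by (simp add: QV.span_zero)
  qed
  then have "qscale (q i i) (B i) \<in> QV.span (A ` I)"
    unfolding eq using less.prems
    by (intro QV.span_diff QV.span_sum) (auto intro: QV.span_base)
  then have "qscale (inverse (q i i)) (qscale (q i i) (B i)) \<in> QV.span (A ` I)"
    by (rule QV.span_scale)
  then show ?case
    using diag[OF less.prems] by simp
qed

lemma span_triangular:
  shows "QV.span (A ` J) = QV.span (A ` I)" and "QV.span (A ` I) = QV.span (B ` I)"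
proof -
  have 1: "QV.span (A ` I) \<subseteq> QV.span (A ` J)"
    using IJ by (intro QV.span_mono image_mono)
  have 2: "QV.span (A ` J) \<subseteq> QV.span (B ` I)"
    by (intro QV.span_minimal QV.subspace_span)
      (auto simp: triangular_expansion intro!: QV.span_sum QV.span_scale intro: QV.span_base)
  have 3: "QV.span (B ` I) \<subseteq> QV.span (A ` I)"
    by (intro QV.span_minimal QV.subspace_span) (auto intro: triangular_inverse)
  from 1 2 3 show "QV.span (A ` J) = QV.span (A ` I)" "QV.span (A ` I) = QV.span (B ` I)"
    by blast+
qed

text \<open>Indices outside \<open>I\<close> have empty classes, so their sums vanish.\<close>

lemma span_classes:
  assumes "I \<subseteq> K"
  shows "QV.span (B ` K) = QV.span (B ` I)"
proof
  have "B i = 0" if "i \<notin> I" for i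
    using that cls by (auto simp: fun_eq_iff B)
  then have "B ` K \<subseteq> insert 0 (B ` I)" by auto
  then show "QV.span (B ` K) \<subseteq> QV.span (B ` I)"
    using QV.span_mono[of "B ` K" "insert 0 (B ` I)"] by simp
  show "QV.span (B ` I) \<subseteq> QV.span (B ` K)"
    using assms by (intro QV.span_mono image_mono)
qed

end

section \<open>Bilinearity and subalgebras given by generators\<close>

lemma int_prod_add_left: "int_prod n (f + f') g = int_prod n f g + int_prod n f' g"
  by (simp add: int_prod_def fun_eq_iff algebra_simps sum.distrib)

lemma int_prod_add_right: "int_prod n f (g + g') = int_prod n f g + int_prod n f g'"
  by (simp add: int_prod_def fun_eq_iff algebra_simps sum.distrib)

lemma int_prod_scale_left: "int_prod n (qscale c f) g = qscale c (int_prod n f g)"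
  by (simp add: int_prod_def fun_eq_iff qscale_def sum_distrib_left mult.assoc)

lemma int_prod_scale_right: "int_prod n f (qscale c g) = qscale c (int_prod n f g)"
  by (simp add: int_prod_def fun_eq_iff qscale_def sum_distrib_left mult_ac)

lemma int_prod_zero: "int_prod n 0 g = 0" "int_prod n f 0 = 0"
  by (simp_all add: int_prod_def fun_eq_iff)

text \<open>By bilinearity, with one factor fixed, the elements whose product lies in
  \<open>U\<close> form a subspace; this is applied to one factor at a time.\<close>

lemma int_prod_span:
  assumes "\<And>x y. x \<in> S \<Longrightarrow> y \<in> T \<Longrightarrow> int_prod n x y \<in> U" "QV.subspace U"
    and "x \<in> QV.span S" "y \<in> QV.span T"
  shows "int_prod n x y \<in> U"
proof -
  have "QV.span S \<subseteq> {x. int_prod n x y \<in> U}" if "y \<in> T" for y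
    using assms(1) that
    by (intro QV.span_minimal QV.subspaceI)
      (auto simp: int_prod_zero int_prod_add_left int_prod_scale_left
        intro: QV.subspace_0 QV.subspace_add QV.subspace_scale assms(2))
  then have "QV.span T \<subseteq> {y. int_prod n x y \<in> U}"
    using assms(3)
    by (intro QV.span_minimal QV.subspaceI)
      (auto simp: int_prod_zero int_prod_add_right int_prod_scale_right
        intro: QV.subspace_0 QV.subspace_add QV.subspace_scale assms(2))
  then show ?thesis using assms(4) by blast
qed

lemma int_prod_commute_span:
  assumes "\<And>x y. x \<in> S \<Longrightarrow> y \<in> T \<Longrightarrow> int_prod n x y = int_prod n y x"
    and "x \<in> QV.span S" "y \<in> QV.span T"
  shows "int_prod n x y = int_prod n y x"
proof -
  have "QV.span S \<subseteq> {x. int_prod n x y = int_prod n y x}" if "y \<in> T" for y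
    using assms(1) that
    by (intro QV.span_minimal QV.subspaceI)
      (auto simp: int_prod_zero int_prod_add_left int_prod_scale_left int_prod_add_right int_prod_scale_right)
  then have "QV.span T \<subseteq> {y. int_prod n x y = int_prod n y x}"
    using assms(2)
    by (intro QV.span_minimal QV.subspaceI)
      (auto simp: int_prod_zero int_prod_add_left int_prod_scale_left int_prod_add_right int_prod_scale_right)
  then show ?thesis using assms(3) by blast
qed

lemma subspace_group_algebra: "QV.subspace (group_algebra n)"
proof -
  have "group_algebra n = {f. \<forall>\<sigma>. \<not> \<sigma> permutes {1..n} \<longrightarrow> f \<sigma> = 0}"
    unfolding group_algebra_def by blast
  then show ?thesis
    by (auto intro!: QV.subspaceI simp: qscale_def)
qed

lemma is_subalgebra_span:
  assumes "S \<subseteq> group_algebra n" "\<And>x y. x \<in> S \<Longrightarrow> y \<in> S \<Longrightarrow> int_prod n x y \<in> QV.span S"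
  shows "is_subalgebra n (QV.span S)"
proof -
  have "QV.span S \<subseteq> group_algebra n"
    using assms(1) subspace_group_algebra by (intro QV.span_minimal)
  moreover have "int_prod n x y \<in> QV.span S" if "x \<in> QV.span S" "y \<in> QV.span S" for x y
    by (rule int_prod_span[OF assms(2) QV.subspace_span that])
  ultimately show ?thesis
    by (simp add: is_subalgebra_def)
qed

lemma comm_subalgebra_of_span:
  assumes "S \<subseteq> group_algebra n" "\<And>x y. x \<in> S \<Longrightarrow> y \<in> S \<Longrightarrow> int_prod n x y \<in> QV.span S"
    and "\<And>x y. x \<in> S \<Longrightarrow> y \<in> S \<Longrightarrow> int_prod n x y = int_prod n y x" "S \<subseteq> QV.span T"
  shows "comm_subalgebra_of n (QV.span S) (QV.span T)"
  unfolding comm_subalgebra_of_def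
  using is_subalgebra_span[OF assms(1,2)] int_prod_commute_span[OF assms(3)]
    QV.span_minimal[OF assms(4) QV.subspace_span] by blast

lemma Vp_eq_Vs: "Vp k n = Vs n True k"
  by (simp add: Vp_eq Vs_def)

lemma Vm_eq_Vs: "Vm k n = Vs n False k"
  by (simp add: Vm_eq Vs_def)

lemma V_eq_Vs: "V k n = Vs n True k + Vs n False k"
  by (simp add: V_eq Vp_eq_Vs Vm_eq_Vs)

lemma Vs_in_group_algebra: "Vs n s k \<in> group_algebra n"
  by (simp add: Vs_def shelf_sum_def group_algebra_def)

lemma Vs_not_permutes: "\<not> \<sigma> permutes {1..n} \<Longrightarrow> Vs n s k \<sigma> = 0"
  by (simp add: Vs_def shelf_sum_def)

lemma V_in_group_algebra: "V k n \<in> group_algebra n"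
  unfolding V_eq_Vs by (intro QV.subspace_add[OF subspace_group_algebra] Vs_in_group_algebra)

text \<open>Among the four pairs of signs each sign of the product occurs twice.\<close>

lemma int_prod_V_V: "int_prod n (V k n) (V l n) = V (k * l) n + V (k * l) n"
  by (simp add: V_eq_Vs int_prod_add_left int_prod_add_right int_prod_Vs)

text \<open>For even \<open>k\<close> the product inherits the sign of the left factor, so summing
  over that sign yields both. The next lemma is the odd counterpart, where signs multiply and the
  sum is over the right one.\<close>

lemma int_prod_V_Vs: "even k \<Longrightarrow> int_prod n (V k n) (Vs n s l) = V (k * l) n"
  by (simp add: V_eq_Vs int_prod_add_left int_prod_Vs)

lemma int_prod_Vs_V: "odd k \<Longrightarrow> int_prod n (Vs n s k) (V l n) = V (k * l) n"
  by (cases s) (simp_all add: V_eq_Vs int_prod_add_right int_prod_Vs add.commute)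

lemma image_bool_Times: "f ` (UNIV \<times> S) = (\<lambda>k. f (True, k)) ` S \<union> (\<lambda>k. f (False, k)) ` S"
proof -
  have "UNIV \<times> S = Pair True ` S \<union> Pair False ` S" by auto
  then show ?thesis by (simp only: image_Un image_image)
qed

text \<open>For even \<open>k\<close> only the index \<open>(True, k)\<close> is used, so that every element is listed once.\<close>

definition VC :: "nat \<Rightarrow> bool \<times> nat \<Rightarrow> (nat \<Rightarrow> nat) \<Rightarrow> rat"
  where "VC n = (\<lambda>(s, k). if odd k then Vs n s k else V k n)"

section \<open>The spans in terms of runs and peaks\<close>

context
  fixes n :: nat
  assumes n: "n \<ge> 2"
begin

lemma span_Wpm:
  "QV.span ((\<lambda>(s, k). Vs n s k) ` (UNIV \<times> {1..})) = QV.span ((\<lambda>(s, k). Vs n s k) ` (UNIV \<times> {1..<n}))"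
  "QV.span ((\<lambda>(s, k). Vs n s k) ` (UNIV \<times> {1..<n})) = Wpm_space n"
proof -
  let ?A = "\<lambda>(s, k). Vs n s k" and ?I = "(UNIV :: bool set) \<times> {1..<n}" and ?J = "UNIV \<times> {1..} :: (bool \<times> nat) set"
  define cls where "cls \<sigma> = (\<sigma> 1 < \<sigma> (2::nat), run n \<sigma>)" for \<sigma> :: "nat \<Rightarrow> nat"
  define B where "B i \<sigma> = (of_bool (\<sigma> permutes {1..n} \<and> cls \<sigma> = i) :: rat)" for i \<sigma>
  \<comment> \<open>The entries follow \<open>changes_eq_run\<close>: there are \<open>r - 1\<close>
    sign changes if the sign agrees with the first step and \<open>r\<close> if not.\<close>
  define q where "q = (\<lambda>(s :: bool, k) (t, r). coef n (if t = s then r - 1 else r) k)"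
  have hyps: "finite ?I" "?I \<subseteq> ?J" "\<And>\<sigma>. \<sigma> permutes {1..n} \<Longrightarrow> cls \<sigma> \<in> ?I"
    "\<And>i \<sigma>. B i \<sigma> = of_bool (\<sigma> permutes {1..n} \<and> cls \<sigma> = i)"
    "\<And>i \<sigma>. i \<in> ?J \<Longrightarrow> ?A i \<sigma> = (if \<sigma> permutes {1..n} then q i (cls \<sigma>) else 0)"
    "\<And>i. i \<in> ?I \<Longrightarrow> q i i \<noteq> 0"
    "\<And>i j. i \<in> ?I \<Longrightarrow> j \<in> ?I \<Longrightarrow> i \<noteq> j \<Longrightarrow> snd i \<le> snd j \<Longrightarrow> q i j = 0"
  proof -
    show "cls \<sigma> \<in> ?I" if "\<sigma> permutes {1..n}" for \<sigma>
      using run_bounds[OF n that] by (simp add: cls_def)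
    show "?A i \<sigma> = (if \<sigma> permutes {1..n} then q i (cls \<sigma>) else 0)" if "i \<in> ?J" for i \<sigma>
      by (auto simp: cls_def q_def Vs_eq_coef[OF n] changes_eq_run[OF n] Vs_not_permutes split: prod.split)
    show "q i i \<noteq> 0" if I: "i \<in> ?I" for i
    proof -
      obtain s k where i: "i = (s, Suc k)" using I by (cases i, cases "snd i") auto
      show ?thesis by (simp add: i q_def coef_Suc)
    qed
    show "q i j = 0" if "i \<in> ?I" "j \<in> ?I" "i \<noteq> j" "snd i \<le> snd j" for i j
    proof -
      obtain s k t r where ij: "i = (s, k)" "j = (t, r)" by (cases i, cases j)
      show ?thesis
      proof (cases "k = r")
        \<comment> \<open>Equal run number but opposite direction: there are \<open>k\<close> sign
          changes, one too many for a contribution in degree \<open>k\<close>.\<close>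
        case True
        with that ij show ?thesis by (auto simp: q_def coef_eq_0)
      next
        case False
        with that ij have "k \<le> r - 1" "k \<le> r" by auto
        then show ?thesis by (simp add: ij q_def coef_eq_0)
      qed
    qed
  qed (auto simp: B_def)
  note span = span_triangular[of ?I ?J n cls B ?A q snd, OF hyps]
  show "QV.span (?A ` ?J) = QV.span (?A ` ?I)" by (rule span(1))
  have "B (True, r) = Wp r n" "B (False, r) = Wm r n" for r
    by (auto simp: fun_eq_iff B_def cls_def Wp_def Wm_def perm_sum_def
        first_run_ascending_iff[OF n] first_run_descending_iff[OF n])
  moreover have "{Wp k n | k. 1 \<le> k \<and> k \<le> n - 1} = (\<lambda>k. Wp k n) ` {1..<n}"
    "{Wm k n | k. 1 \<le> k \<and> k \<le> n - 1} = (\<lambda>k. Wm k n) ` {1..<n}"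
    using n by (auto simp: image_iff intro!: exI bexI)
  ultimately have set_eq:
    "{Wp k n | k. 1 \<le> k \<and> k \<le> n - 1} \<union> {Wm k n | k. 1 \<le> k \<and> k \<le> n - 1} = B ` ?I"
    by (simp only: image_bool_Times)
  show "QV.span (?A ` ?I) = Wpm_space n"
    unfolding Wpm_space_def set_eq by (rule span(2))
qed

lemma V_eq_coef:
  assumes "\<sigma> permutes {1..n}"
  shows "V k n \<sigma> = coef n (run n \<sigma> - 1) k + coef n (run n \<sigma>) k"
  by (simp add: V_eq_Vs Vs_eq_coef[OF n assms] changes_eq_run[OF n assms])

lemma V_not_permutes: "\<not> \<sigma> permutes {1..n} \<Longrightarrow> V k n \<sigma> = 0"
  by (simp add: V_eq_Vs Vs_not_permutes)

lemma W_eq: "W k n \<sigma> = of_bool (\<sigma> permutes {1..n} \<and> run n \<sigma> = k)"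
  by (auto simp: W_def Wp_def Wm_def perm_sum_def
      first_run_ascending_iff[OF n] first_run_descending_iff[OF n])

lemma span_W:
  "QV.span ((\<lambda>k. V k n) ` {1..}) = QV.span ((\<lambda>k. V k n) ` {1..<n})"
  "QV.span ((\<lambda>k. V k n) ` {1..<n}) = W_space n"
proof -
  let ?I = "{1..<n}" and ?J = "{1..} :: nat set"
  \<comment> \<open>The two signs see \<open>r - 1\<close> and \<open>r\<close> changes; the second
    term vanishes on the diagonal.\<close>
  define q where "q k r = coef n (r - 1) k + coef n r k" for k r
  have hyps: "finite ?I" "?I \<subseteq> ?J" "\<And>\<sigma>. \<sigma> permutes {1..n} \<Longrightarrow> run n \<sigma> \<in> ?I"
    "\<And>i \<sigma>. W i n \<sigma> = of_bool (\<sigma> permutes {1..n} \<and> run n \<sigma> = i)"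
    "\<And>i \<sigma>. i \<in> ?J \<Longrightarrow> V i n \<sigma> = (if \<sigma> permutes {1..n} then q i (run n \<sigma>) else 0)"
    "\<And>i. i \<in> ?I \<Longrightarrow> q i i \<noteq> 0"
    "\<And>i j. i \<in> ?I \<Longrightarrow> j \<in> ?I \<Longrightarrow> i \<noteq> j \<Longrightarrow> i \<le> j \<Longrightarrow> q i j = 0"
  proof -
    show "run n \<sigma> \<in> ?I" if "\<sigma> permutes {1..n}" for \<sigma>
      using run_bounds[OF n that] by simp
    show "V i n \<sigma> = (if \<sigma> permutes {1..n} then q i (run n \<sigma>) else 0)" for i \<sigma>
      using V_eq_coef V_not_permutes by (simp add: q_def)
    show "q i i \<noteq> 0" if I: "i \<in> ?I" for i
    proof -
      obtain k where i: "i = Suc k" using I by (cases i) auto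
      show ?thesis by (simp add: i q_def coef_Suc coef_eq_0)
    qed
    show "q i j = 0" if "i \<in> ?I" "j \<in> ?I" "i \<noteq> j" "i \<le> j" for i j
      using that by (simp add: q_def coef_eq_0)
  qed (auto simp: W_eq)
  note span = span_triangular[of ?I ?J n "run n" "\<lambda>k. W k n" "\<lambda>k. V k n" q "\<lambda>k. k", OF hyps]
  show "QV.span ((\<lambda>k. V k n) ` ?J) = QV.span ((\<lambda>k. V k n) ` ?I)" by (rule span(1))
  have set_eq: "{W k n | k. 1 \<le> k \<and> k \<le> n - 1} = (\<lambda>k. W k n) ` ?I"
    using n by (auto simp: image_iff intro!: exI bexI)
  show "QV.span ((\<lambda>k. V k n) ` ?I) = W_space n"
    unfolding W_space_def set_eq by (rule span(2))
qed

lemma span_W_left: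
  "QV.span (Vs n True ` {1..}) = QV.span (Vs n True ` {1..n})"
  "QV.span (Vs n True ` {1..n}) = W_left_space n"
proof -
  let ?I = "{1..n}" and ?J = "{1..} :: nat set"
  define q where "q k r = coef n (r - 1) k" for k r
  have hyps: "finite ?I" "?I \<subseteq> ?J" "\<And>\<sigma>. \<sigma> permutes {1..n} \<Longrightarrow> left_run n \<sigma> \<in> ?I"
    "\<And>i \<sigma>. W_left i n \<sigma> = of_bool (\<sigma> permutes {1..n} \<and> left_run n \<sigma> = i)"
    "\<And>i \<sigma>. i \<in> ?J \<Longrightarrow> Vs n True i \<sigma> = (if \<sigma> permutes {1..n} then q i (left_run n \<sigma>) else 0)"
    "\<And>i. i \<in> ?I \<Longrightarrow> q i i \<noteq> 0"
    "\<And>i j. i \<in> ?I \<Longrightarrow> j \<in> ?I \<Longrightarrow> i \<noteq> j \<Longrightarrow> i \<le> j \<Longrightarrow> q i j = 0"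
  proof -
    show "left_run n \<sigma> \<in> ?I" if "\<sigma> permutes {1..n}" for \<sigma>
      using changes_word_less[OF n that, of True] left_run_eq_changes[OF n that] by simp
    show "Vs n True i \<sigma> = (if \<sigma> permutes {1..n} then q i (left_run n \<sigma>) else 0)" for i \<sigma>
      by (simp add: q_def Vs_eq_coef[OF n] left_run_eq_changes[OF n] Vs_not_permutes)
    show "q i i \<noteq> 0" if I: "i \<in> ?I" for i
    proof -
      obtain k where i: "i = Suc k" using I by (cases i) auto
      show ?thesis by (simp add: i q_def coef_Suc)
    qed
    show "q i j = 0" if "i \<in> ?I" "j \<in> ?I" "i \<noteq> j" "i \<le> j" for i j
      using that by (simp add: q_def coef_eq_0)
  qed (auto simp: W_left_def perm_sum_def)
  note span = span_triangular[of ?I ?J n "left_run n" "\<lambda>k. W_left k n" "Vs n True" q "\<lambda>k. k", OF hyps]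
  show "QV.span (Vs n True ` ?J) = QV.span (Vs n True ` ?I)" by (rule span(1))
  have set_eq: "{W_left k n | k. 1 \<le> k \<and> k \<le> n} = (\<lambda>k. W_left k n) ` ?I"
    by (auto simp: image_iff intro!: exI bexI)
  show "QV.span (Vs n True ` ?I) = W_left_space n"
    unfolding W_left_space_def set_eq by (rule span(2))
qed

lemma span_P:
  "QV.span (range (\<lambda>p. Vs n False (2 * p + 2))) = QV.span ((\<lambda>p. Vs n False (2 * p + 2)) ` {p. 2 * p < n})"
  "QV.span ((\<lambda>p. Vs n False (2 * p + 2)) ` {p. 2 * p < n}) = P_space n"
proof -
  let ?I = "{p. 2 * p < n}" and ?A = "\<lambda>p. Vs n False (2 * p + 2)"
  let ?B = "\<lambda>k. perm_sum n (\<lambda>\<sigma>. card (peaks n \<sigma>) = k)"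
  \<comment> \<open>A permutation with \<open>p\<close> peaks has \<open>2 * p\<close> or
    \<open>2 * p + 1\<close> changes after a negative sign. By \<open>coef_lump\<close> even degrees
    do not distinguish the two, so the smaller stands for the class. The degree is
    \<open>2 * k\<close> with \<open>k = i + 1\<close>.\<close>
  define q where "q i p = coef n (2 * p) (2 * i + 2)" for i p
  have hyps: "finite ?I" "?I \<subseteq> UNIV" "\<And>\<sigma>. \<sigma> permutes {1..n} \<Longrightarrow> card (peaks n \<sigma>) \<in> ?I"
    "\<And>i \<sigma>. ?B i \<sigma> = of_bool (\<sigma> permutes {1..n} \<and> card (peaks n \<sigma>) = i)"
    "\<And>i \<sigma>. i \<in> UNIV \<Longrightarrow> ?A i \<sigma> = (if \<sigma> permutes {1..n} then q i (card (peaks n \<sigma>)) else 0)"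
    "\<And>i. i \<in> ?I \<Longrightarrow> q i i \<noteq> 0"
    "\<And>i j. i \<in> ?I \<Longrightarrow> j \<in> ?I \<Longrightarrow> i \<noteq> j \<Longrightarrow> i \<le> j \<Longrightarrow> q i j = 0"
  proof -
    show "finite ?I" by (rule finite_subset[of _ "{..n}"]) auto
    show "card (peaks n \<sigma>) \<in> ?I" if "\<sigma> permutes {1..n}" for \<sigma>
      using changes_word_less[OF n that, of False] card_peaks[OF n that] by auto
    show "?A i \<sigma> = (if \<sigma> permutes {1..n} then q i (card (peaks n \<sigma>)) else 0)" for i \<sigma>
    proof (cases "\<sigma> permutes {1..n}")
      case True
      define c where "c = changes False (word n \<sigma>)"
      have c: "c < n" using changes_word_less[OF n True] by (simp add: c_def)
      have "coef n c (2 * i + 2) = coef n (2 * (c div 2)) (2 * i + 2)"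
      proof (cases "even c")
        case False
        then have "c = Suc (2 * (c div 2))" by simp
        then show ?thesis using c coef_lump[of "2 * (c div 2)" n "2 * i + 2"] by simp
      qed simp
      with True show ?thesis
        by (simp add: Vs_eq_coef[OF n True] card_peaks[OF n True] q_def c_def)
    qed (simp add: Vs_not_permutes)
    show "q i i \<noteq> 0" for i
      \<comment> \<open>The diagonal entry is the second lowest coefficient, since the lowest one
        sits in an odd degree.\<close>
      using coef_Suc_Suc[of n "2 * i"] by (simp add: q_def)
    show "q i j = 0" if "i \<in> ?I" "j \<in> ?I" "i \<noteq> j" "i \<le> j" for i j
      using that by (simp add: q_def coef_eq_0)
  qed (auto simp: perm_sum_def)
  note inst = span_triangular[of ?I UNIV n "\<lambda>\<sigma>. card (peaks n \<sigma>)" ?B ?A q "\<lambda>k. k", OF hyps]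
  show "QV.span (range ?A) = QV.span (?A ` ?I)" by (rule inst(1))
  have classes: "QV.span (range ?B) = QV.span (?B ` ?I)"
    by (rule span_classes[of ?I UNIV n "\<lambda>\<sigma>. card (peaks n \<sigma>)" ?B ?A q "\<lambda>k. k", OF hyps subset_UNIV])
  have set_eq: "{?B k | k. True} = range ?B" by auto
  show "QV.span (?A ` ?I) = P_space n"
    unfolding P_space_def set_eq classes by (rule inst(2))
qed

lemma span_P_left:
  "QV.span (range (\<lambda>p. Vs n True (2 * p + 1))) = QV.span ((\<lambda>p. Vs n True (2 * p + 1)) ` {p. 2 * p \<le> n})"
  "QV.span ((\<lambda>p. Vs n True (2 * p + 1)) ` {p. 2 * p \<le> n}) = P_left_space n"
proof -
  let ?I = "{p. 2 * p \<le> n}" and ?A = "\<lambda>p. Vs n True (2 * p + 1)"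
  let ?B = "\<lambda>k. perm_sum n (\<lambda>\<sigma>. card (left_peaks n \<sigma>) = k)"
  \<comment> \<open>With \<open>p > 0\<close> left peaks there are \<open>2 * p - 1\<close> or
    \<open>2 * p\<close> changes after a positive sign, which odd degrees do not distinguish. For
    \<open>p = 0\<close> there are none, and truncated subtraction gives the right value 0.\<close>
  define q where "q i p = coef n (2 * p - 1) (2 * i + 1)" for i p
  have hyps: "finite ?I" "?I \<subseteq> UNIV" "\<And>\<sigma>. \<sigma> permutes {1..n} \<Longrightarrow> card (left_peaks n \<sigma>) \<in> ?I"
    "\<And>i \<sigma>. ?B i \<sigma> = of_bool (\<sigma> permutes {1..n} \<and> card (left_peaks n \<sigma>) = i)"
    "\<And>i \<sigma>. i \<in> UNIV \<Longrightarrow> ?A i \<sigma> = (if \<sigma> permutes {1..n} then q i (card (left_peaks n \<sigma>)) else 0)"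
    "\<And>i. i \<in> ?I \<Longrightarrow> q i i \<noteq> 0"
    "\<And>i j. i \<in> ?I \<Longrightarrow> j \<in> ?I \<Longrightarrow> i \<noteq> j \<Longrightarrow> i \<le> j \<Longrightarrow> q i j = 0"
  proof -
    show "finite ?I" by (rule finite_subset[of _ "{..n}"]) auto
    show "card (left_peaks n \<sigma>) \<in> ?I" if "\<sigma> permutes {1..n}" for \<sigma>
      using changes_word_less[OF n that, of True] card_left_peaks[OF n that] by auto
    show "?A i \<sigma> = (if \<sigma> permutes {1..n} then q i (card (left_peaks n \<sigma>)) else 0)" for i \<sigma>
    proof (cases "\<sigma> permutes {1..n}")
      case True
      define c where "c = changes True (word n \<sigma>)"
      have c: "c < n" using changes_word_less[OF n True] by (simp add: c_def)
      have "coef n c (2 * i + 1) = coef n (2 * (Suc c div 2) - 1) (2 * i + 1)"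
      proof (cases "odd c \<or> c = 0")
        case False
        then obtain d where "c = 2 * Suc d" by (metis evenE not0_implies_Suc mult_0_right)
        then show ?thesis using c coef_lump[of "2 * d + 1" n "2 * i + 1"] by simp
      qed (auto elim!: oddE)
      with True show ?thesis
        by (simp add: Vs_eq_coef[OF n True] card_left_peaks[OF n True] q_def c_def)
    qed (simp add: Vs_not_permutes)
    show "q i i \<noteq> 0" for i
    proof (cases i)
      case 0
      then show ?thesis using coef_Suc[of n 0] by (simp add: q_def)
    next
      case (Suc d)
      then show ?thesis using coef_Suc_Suc[of n "2 * d + 1"] by (simp add: q_def)
    qed
    show "q i j = 0" if "i \<in> ?I" "j \<in> ?I" "i \<noteq> j" "i \<le> j" for i j
      using that by (simp add: q_def coef_eq_0)
  qed (auto simp: perm_sum_def)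
  note inst = span_triangular[of ?I UNIV n "\<lambda>\<sigma>. card (left_peaks n \<sigma>)" ?B ?A q "\<lambda>k. k", OF hyps]
  show "QV.span (range ?A) = QV.span (?A ` ?I)" by (rule inst(1))
  have classes: "QV.span (range ?B) = QV.span (?B ` ?I)"
    by (rule span_classes[of ?I UNIV n "\<lambda>\<sigma>. card (left_peaks n \<sigma>)" ?B ?A q "\<lambda>k. k", OF hyps subset_UNIV])
  have set_eq: "{?B k | k. True} = range ?B" by auto
  show "QV.span (?A ` ?I) = P_left_space n"
    unfolding P_left_space_def set_eq classes by (rule inst(2))
qed

lemma span_C:
  "QV.span (VC n ` {(s, k). odd k \<or> s}) = QV.span (VC n ` {(s, k). 1 \<le> k \<and> k < n \<and> (odd k \<or> s)})"
  "QV.span (VC n ` {(s, k). 1 \<le> k \<and> k < n \<and> (odd k \<or> s)}) = C_space n"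
proof -
  let ?I = "{(s, k). 1 \<le> k \<and> k < n \<and> (odd k \<or> s)}" and ?J = "{(s, k). odd (k::nat) \<or> s}"
  \<comment> \<open>The first component records the direction for an odd number of runs; for an even
    number it is always \<open>True\<close>, so the direction is forgotten.\<close>
  define cls where "cls \<sigma> = (\<sigma> 1 < \<sigma> (2::nat) \<or> even (run n \<sigma>), run n \<sigma>)" for \<sigma> :: "nat \<Rightarrow> nat"
  define B where "B i \<sigma> = (of_bool (\<sigma> permutes {1..n} \<and> cls \<sigma> = i) :: rat)" for i \<sigma>
  define q where "q = (\<lambda>(s :: bool, k) (t, r).
    if odd k then (if odd r \<and> t = s then coef n (r - 1) k else coef n r k)
    else coef n (r - 1) k + coef n r k)"
  have hyps: "finite ?I" "?I \<subseteq> ?J" "\<And>\<sigma>. \<sigma> permutes {1..n} \<Longrightarrow> cls \<sigma> \<in> ?I"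
    "\<And>i \<sigma>. B i \<sigma> = of_bool (\<sigma> permutes {1..n} \<and> cls \<sigma> = i)"
    "\<And>i \<sigma>. i \<in> ?J \<Longrightarrow> VC n i \<sigma> = (if \<sigma> permutes {1..n} then q i (cls \<sigma>) else 0)"
    "\<And>i. i \<in> ?I \<Longrightarrow> q i i \<noteq> 0"
    "\<And>i j. i \<in> ?I \<Longrightarrow> j \<in> ?I \<Longrightarrow> i \<noteq> j \<Longrightarrow> snd i \<le> snd j \<Longrightarrow> q i j = 0"
  proof -
    show "finite ?I" by (rule finite_subset[of _ "UNIV \<times> {..n}"]) auto
    show "cls \<sigma> \<in> ?I" if "\<sigma> permutes {1..n}" for \<sigma>
      using run_bounds[OF n that] by (simp add: cls_def)
    show "VC n i \<sigma> = (if \<sigma> permutes {1..n} then q i (cls \<sigma>) else 0)" if "i \<in> ?J" for i \<sigma>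
    proof (cases "\<sigma> permutes {1..n}")
      case True
      obtain s k where i: "i = (s, k)" by (cases i)
      define r where "r = run n \<sigma>"
      have r: "1 \<le> r" "r < n" using run_bounds[OF n True] by (simp_all add: r_def)
      show ?thesis
      proof (cases "odd k")
        case k: True
        \<comment> \<open>For even \<open>r\<close> an odd degree does not distinguish
          \<open>r - 1\<close> from \<open>r\<close> changes, so both signs of the series take the
          same value there.\<close>
        have "coef n (r - 1) k = coef n r k" if "even r"
        proof -
          obtain m where "r = Suc m" using r by (cases r) auto
          with that k r show ?thesis using coef_lump[of m n k] by simp
        qed
        with k True show ?thesis
          by (auto simp: i VC_def cls_def q_def Vs_eq_coef[OF n True] changes_eq_run[OF n True] simp flip: r_def)
      next
        case False
        with True show ?thesis by (simp add: i VC_def cls_def q_def V_eq_coef)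
      qed
    qed (auto simp: VC_def Vs_not_permutes V_not_permutes split: prod.split)
    show "q i i \<noteq> 0" if I: "i \<in> ?I" for i
    proof -
      obtain s k where i: "i = (s, Suc k)" using I by (cases i, cases "snd i") auto
      show ?thesis by (simp add: i q_def coef_Suc coef_eq_0)
    qed
    show "q i j = 0" if "i \<in> ?I" "j \<in> ?I" "i \<noteq> j" "snd i \<le> snd j" for i j
    proof -
      obtain s k t r where ij: "i = (s, k)" "j = (t, r)" by (cases i, cases j)
      show ?thesis
      proof (cases "k = r")
        case True
        with that ij show ?thesis by (auto simp: q_def coef_eq_0)
      next
        case False
        with that ij have "k \<le> r - 1" "k \<le> r" by auto
        then show ?thesis by (simp add: ij q_def coef_eq_0)
      qed
    qed
  qed (auto simp: B_def)
  note inst = span_triangular[of ?I ?J n cls B "VC n" q snd, OF hyps]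
  show "QV.span (VC n ` ?J) = QV.span (VC n ` ?I)" by (rule inst(1))
  \<comment> \<open>The defining generators of \<open>C_space\<close> are not bounded by
    \<open>n\<close>; the surplus ones are sums over empty classes.\<close>
  let ?K = "{(s, k). 1 \<le> k \<and> (odd (k::nat) \<or> s)}"
  have 1: "QV.span (B ` ?K) = QV.span (B ` ?I)"
    by (rule span_classes[of ?I ?J n cls B "VC n" q snd, OF hyps]) auto
  have even_B: "B (True, r) = W r n" if "even r" for r
    using that by (auto simp: fun_eq_iff B_def cls_def W_eq)
  have odd_B: "B (True, r) = Wp r n" "B (False, r) = Wm r n" if "odd r" for r
    using that by (auto simp: fun_eq_iff B_def cls_def Wp_def Wm_def perm_sum_def
        first_run_ascending_iff[OF n] first_run_descending_iff[OF n])
  let ?E = "{W (2 * k) n | k. 1 \<le> k}"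
    and ?O = "{Wp (2 * k - 1) n | k. 1 \<le> k} \<union> {Wm (2 * k - 1) n | k. 1 \<le> k}"
  have "B ` ?K = ?E \<union> ?O"
  proof (intro equalityI subsetI)
    fix x assume "x \<in> B ` ?K"
    then obtain s k where x: "x = B (s, k)" "1 \<le> k" "odd k \<or> s" by auto
    show "x \<in> ?E \<union> ?O"
    proof (cases "even k")
      case True
      then obtain m where "k = 2 * m" by blast
      with x True have "x = W (2 * m) n" "1 \<le> m" using even_B[of k] by auto
      then have "x \<in> ?E" by blast
      then show ?thesis by (rule UnI1)
    next
      case False
      then obtain m where m: "k = 2 * Suc m - 1" by (auto elim: oddE)
      show ?thesis
      proof (cases s)
        case True
        with False x have "x = Wp (2 * Suc m - 1) n" using odd_B(1)[of k] m by simp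
        then have "x \<in> {Wp (2 * k - 1) n | k. 1 \<le> k}"
          by (intro CollectI exI[of _ "Suc m"]) simp
        then show ?thesis by (rule UnI2[OF UnI1])
      next
        case False
        with \<open>odd k\<close> x have "x = Wm (2 * Suc m - 1) n" using odd_B(2)[of k] m by simp
        then have "x \<in> {Wm (2 * k - 1) n | k. 1 \<le> k}"
          by (intro CollectI exI[of _ "Suc m"]) simp
        then show ?thesis by (rule UnI2[OF UnI2])
      qed
    qed
  next
    fix x assume "x \<in> ?E \<union> ?O"
    then consider m where "x = W (2 * m) n" "1 \<le> m" | m where "x = Wp (2 * m - 1) n" "1 \<le> m"
      | m where "x = Wm (2 * m - 1) n" "1 \<le> m"
      by blast
    then show "x \<in> B ` ?K"
    proof cases
      case 1
      then have "x = B (True, 2 * m)" using even_B by simp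
      moreover have "(True, 2 * m) \<in> ?K" using 1(2) by auto
      ultimately show ?thesis by (rule image_eqI)
    next
      case 2
      then have "x = B (True, 2 * m - 1)" using odd_B(1) by simp
      moreover have "(True, 2 * m - 1) \<in> ?K" using 2(2) by auto
      ultimately show ?thesis by (rule image_eqI)
    next
      case 3
      then have "x = B (False, 2 * m - 1)" using odd_B(2) by simp
      moreover have "(False, 2 * m - 1) \<in> ?K" using 3(2) by auto
      ultimately show ?thesis by (rule image_eqI)
    qed
  qed
  then have "QV.span (B ` ?K) = {x + y | x y. x \<in> QV.span ?E \<and> y \<in> QV.span ?O}"
    by (simp only: QV.span_Un)
  also have "\<dots> = C_space n"
    by (simp only: C_space_def C_even_space_def C_odd_space_def QV.span_delete_0)
  finally show "QV.span (VC n ` ?I) = C_space n"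
    using 1 inst(2) by simp
qed

end

section \<open>Generating families as images of index sets\<close>

lemma generators_eq:
  "{Vp k n | k. k \<ge> 1} \<union> {Vm k n | k. k \<ge> 1} = (\<lambda>(s, k). Vs n s k) ` (UNIV \<times> {1..})"
  "{Vp k n | k. 1 \<le> k \<and> k < n} \<union> {Vm k n | k. 1 \<le> k \<and> k < n} =
    (\<lambda>(s, k). Vs n s k) ` (UNIV \<times> {1..<n})"
  "{V k n | k. k \<ge> 1} = (\<lambda>k. V k n) ` {1..}"
  "{V k n | k. 1 \<le> k \<and> k < n} = (\<lambda>k. V k n) ` {1..<n}"
  "{Vp k n | k. k \<ge> 1} = Vs n True ` {1..}"
  "{Vp k n | k. 1 \<le> k \<and> k \<le> n} = Vs n True ` {1..n}"
  unfolding Vp_eq_Vs Vm_eq_Vs by (auto simp: image_iff UNIV_bool)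

lemma peak_generators_eq:
  "{Vm (2 * k) n | k. k \<ge> 1} = range (\<lambda>p. Vs n False (2 * p + 2))"
  "{Vm (2 * k) n | k. 1 \<le> 2 * k \<and> 2 * k \<le> n + 1} = (\<lambda>p. Vs n False (2 * p + 2)) ` {p. 2 * p < n}"
  "{Vp (2 * k + 1) n | k. k \<ge> 0} = range (\<lambda>p. Vs n True (2 * p + 1))"
  "{Vp (2 * k + 1) n | k. 1 \<le> 2 * k + 1 \<and> 2 * k + 1 \<le> n + 1} =
    (\<lambda>p. Vs n True (2 * p + 1)) ` {p. 2 * p \<le> n}"
proof -
  \<comment> \<open>The range conditions exclude the index 0, so \<open>k = p + 1\<close> can be
    substituted.\<close>
  have *: "{f k | k. P k} = (\<lambda>p. f (Suc p)) ` {p. P (Suc p)}" if "\<not> P 0"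
    for P :: "nat \<Rightarrow> bool" and f :: "nat \<Rightarrow> (nat \<Rightarrow> nat) \<Rightarrow> rat"
  proof (intro equalityI subsetI)
    fix x assume "x \<in> {f k | k. P k}"
    then obtain k where "x = f k" "P k" by blast
    with that show "x \<in> (\<lambda>p. f (Suc p)) ` {p. P (Suc p)}" by (cases k) auto
  qed auto
  show "{Vm (2 * k) n | k. k \<ge> 1} = range (\<lambda>p. Vs n False (2 * p + 2))"
    unfolding Vm_eq_Vs by (subst *) simp_all
  show "{Vm (2 * k) n | k. 1 \<le> 2 * k \<and> 2 * k \<le> n + 1} =
      (\<lambda>p. Vs n False (2 * p + 2)) ` {p. 2 * p < n}"
    unfolding Vm_eq_Vs by (subst *) (simp_all add: Suc_le_eq)
qed (auto simp: Vp_eq_Vs)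

lemma C_generators_eq:
  "{Vp (2 * k + 1) n | k. k \<ge> 0} \<union> {Vm (2 * k + 1) n | k. k \<ge> 0} \<union> {V (2 * k) n | k. k \<ge> 0}
    = VC n ` {(s, k). odd k \<or> s}"
  "{Vp (2 * k + 1) n | k. 1 \<le> 2 * k + 1 \<and> 2 * k + 1 < n}
    \<union> {Vm (2 * k + 1) n | k. 1 \<le> 2 * k + 1 \<and> 2 * k + 1 < n}
    \<union> {V (2 * l) n | l. 1 \<le> 2 * l \<and> 2 * l < n}
    = VC n ` {(s, k). 1 \<le> k \<and> k < n \<and> (odd k \<or> s)}"
proof -
  have *: "{Vp (2 * k + 1) n | k. P (2 * k + 1)} \<union> {Vm (2 * k + 1) n | k. P (2 * k + 1)}
      \<union> {V (2 * l) n | l. P (2 * l)} = VC n ` {(s, k). P k \<and> (odd k \<or> s)}" for P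
  proof (intro equalityI subsetI)
    fix x assume "x \<in> VC n ` {(s, k). P k \<and> (odd k \<or> s)}"
    then obtain s k where x: "x = VC n (s, k)" "P k" "odd k \<or> s" by auto
    show "x \<in> {Vp (2 * k + 1) n | k. P (2 * k + 1)} \<union> {Vm (2 * k + 1) n | k. P (2 * k + 1)}
      \<union> {V (2 * l) n | l. P (2 * l)}"
    proof (cases "even k")
      case True
      then obtain m where "k = 2 * m" by blast
      with x show ?thesis by (auto simp: VC_def)
    next
      case False
      then obtain m where "k = 2 * m + 1" by (blast elim: oddE)
      with x show ?thesis by (cases s) (auto simp: VC_def Vp_eq_Vs Vm_eq_Vs)
    qed
  next
    fix x assume "x \<in> {Vp (2 * k + 1) n | k. P (2 * k + 1)} \<union> {Vm (2 * k + 1) n | k. P (2 * k + 1)}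
      \<union> {V (2 * l) n | l. P (2 * l)}"
    then consider m where "x = VC n (True, 2 * m + 1)" "P (2 * m + 1)"
      | m where "x = VC n (False, 2 * m + 1)" "P (2 * m + 1)"
      | m where "x = VC n (True, 2 * m)" "P (2 * m)"
      by (auto simp: VC_def Vp_eq_Vs Vm_eq_Vs)
    then show "x \<in> VC n ` {(s, k). P k \<and> (odd k \<or> s)}"
      by cases (auto intro!: imageI)
  qed
  show "{Vp (2 * k + 1) n | k. k \<ge> 0} \<union> {Vm (2 * k + 1) n | k. k \<ge> 0} \<union> {V (2 * k) n | k. k \<ge> 0}
    = VC n ` {(s, k). odd k \<or> s}"
    using *[of "\<lambda>_. True"] by simp
  show "{Vp (2 * k + 1) n | k. 1 \<le> 2 * k + 1 \<and> 2 * k + 1 < n}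
    \<union> {Vm (2 * k + 1) n | k. 1 \<le> 2 * k + 1 \<and> 2 * k + 1 < n}
    \<union> {V (2 * l) n | l. 1 \<le> 2 * l \<and> 2 * l < n}
    = VC n ` {(s, k). 1 \<le> k \<and> k < n \<and> (odd k \<or> s)}"
    using *[of "\<lambda>k. 1 \<le> k \<and> k < n"] by (simp only: conj_assoc)
qed

section \<open>Closure and commutativity of the generators\<close>

lemma Vs_in_span: "k \<ge> 1 \<Longrightarrow> Vs n s k \<in> QV.span ((\<lambda>(s, k). Vs n s k) ` (UNIV \<times> {1..}))"
  by (rule QV.span_base) (auto simp: image_iff)

lemma V_in_span: "k \<ge> 1 \<Longrightarrow> V k n \<in> QV.span ((\<lambda>(s, k). Vs n s k) ` (UNIV \<times> {1..}))"
  unfolding V_eq_Vs by (intro QV.span_add Vs_in_span)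

lemma is_subalgebra_Vs: "is_subalgebra n (QV.span ((\<lambda>(s, k). Vs n s k) ` (UNIV \<times> {1..})))"
proof (rule is_subalgebra_span)
  fix x y assume "x \<in> (\<lambda>(s, k). Vs n s k) ` (UNIV \<times> {1..})" "y \<in> (\<lambda>(s, k). Vs n s k) ` (UNIV \<times> {1..})"
  then obtain s k t l where x: "x = Vs n s k" "k \<ge> 1" and y: "y = Vs n t l" "l \<ge> 1"
    by auto
  then have "k * l \<ge> 1" by simp
  then show "int_prod n x y \<in> QV.span ((\<lambda>(s, k). Vs n s k) ` (UNIV \<times> {1..}))"
    unfolding x y int_prod_Vs by (rule Vs_in_span)
qed (auto simp: Vs_in_group_algebra)

text \<open>By \<open>int_prod_Vs\<close> products of generators are generators again, so closure
  and commutativity become conditions on the index set: stability under the product rule, and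
  symmetry of the resulting sign.\<close>

lemma comm_subalgebra_subset_Vs:
  assumes "K \<subseteq> UNIV \<times> {1..}"
    and "\<And>s k t l. (s, k) \<in> K \<Longrightarrow> (t, l) \<in> K \<Longrightarrow> (if even k then s else s = t, k * l) \<in> K"
    and "\<And>s k t l. (s, k) \<in> K \<Longrightarrow> (t, l) \<in> K \<Longrightarrow>
      (if even k then s else s = t) = (if even l then t else t = s)"
  shows "comm_subalgebra_of n (QV.span ((\<lambda>(s, k). Vs n s k) ` K))
    (QV.span ((\<lambda>(s, k). Vs n s k) ` (UNIV \<times> {1..})))"
proof (rule comm_subalgebra_of_span)
  show "(\<lambda>(s, k). Vs n s k) ` K \<subseteq> QV.span ((\<lambda>(s, k). Vs n s k) ` (UNIV \<times> {1..}))"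
    using assms(1) by (meson QV.span_superset image_mono order.trans)
  fix x y assume "x \<in> (\<lambda>(s, k). Vs n s k) ` K" "y \<in> (\<lambda>(s, k). Vs n s k) ` K"
  then obtain s k t l where x: "x = Vs n s k" "(s, k) \<in> K" and y: "y = Vs n t l" "(t, l) \<in> K"
    by auto
  have "int_prod n x y = (\<lambda>(s, k). Vs n s k) (if even k then s else s = t, k * l)"
    by (simp add: x y int_prod_Vs)
  then show "int_prod n x y \<in> QV.span ((\<lambda>(s, k). Vs n s k) ` K)"
    using assms(2)[OF x(2) y(2)] by (simp only: QV.span_base imageI)
  show "int_prod n x y = int_prod n y x"
    unfolding x y int_prod_Vs assms(3)[OF x(2) y(2)] by (simp only: mult.commute)
qed (auto simp: Vs_in_group_algebra)

lemma comm_subalgebra_V: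
  "comm_subalgebra_of n (QV.span ((\<lambda>k. V k n) ` {1..})) (QV.span ((\<lambda>(s, k). Vs n s k) ` (UNIV \<times> {1..})))"
proof (rule comm_subalgebra_of_span)
  fix x y assume "x \<in> (\<lambda>k. V k n) ` {1..}" "y \<in> (\<lambda>k. V k n) ` {1..}"
  then obtain k l where x: "x = V k n" "1 \<le> k" and y: "y = V l n" "1 \<le> l"
    by auto
  have "V (k * l) n \<in> (\<lambda>k. V k n) ` {1..}" using x y by simp
  then show "int_prod n x y \<in> QV.span ((\<lambda>k. V k n) ` {1..})"
    unfolding x y int_prod_V_V by (intro QV.span_add QV.span_base)
  show "int_prod n x y = int_prod n y x"
    unfolding x y int_prod_V_V by (simp only: mult.commute)
next
  show "(\<lambda>k. V k n) ` {1..} \<subseteq> QV.span ((\<lambda>(s, k). Vs n s k) ` (UNIV \<times> {1..}))"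
    by (intro image_subsetI V_in_span) simp
qed (auto simp: V_in_group_algebra)

text \<open>The empty sign word has no block to hold a letter. This covers \<open>k = 0\<close>,
  where the family for \<open>C_space\<close> starts.\<close>

lemma V_0: "n \<ge> 1 \<Longrightarrow> V 0 n = 0"
proof
  fix \<sigma> assume "n \<ge> 1"
  then have "word n \<sigma> \<noteq> []" by (metis length_word list.size(3) not_one_le_zero)
  then show "V 0 n \<sigma> = 0 \<sigma>" by (simp add: V_eq_Vs Vs_def shelf_sum_def)
qed

text \<open>By parity of the indices: two odd ones multiply their signs, two even ones give twice an
  even element, and a mixed pair gives an even element in either order.\<close>

lemma comm_subalgebra_VC:
  assumes "n \<ge> 1"
  shows "comm_subalgebra_of n (QV.span (VC n ` {(s, k). odd k \<or> s}))
    (QV.span ((\<lambda>(s, k). Vs n s k) ` (UNIV \<times> {1..})))"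
proof (rule comm_subalgebra_of_span)
  let ?K = "{(s, k). odd k \<or> s}"
  have "VC n (s, k) \<in> QV.span ((\<lambda>(s, k). Vs n s k) ` (UNIV \<times> {1..}))" for s k
  proof (cases "k = 0")
    case True
    then show ?thesis using assms by (simp add: VC_def V_0 QV.span_zero)
  next
    case False
    then have "k \<ge> 1" by simp
    then show ?thesis using Vs_in_span V_in_span unfolding VC_def by (simp only: prod.case split: if_split) blast
  qed
  then show "VC n ` ?K \<subseteq> QV.span ((\<lambda>(s, k). Vs n s k) ` (UNIV \<times> {1..}))" by auto
  fix x y assume "x \<in> VC n ` ?K" "y \<in> VC n ` ?K"
  then obtain s k t l where x: "x = VC n (s, k)" "odd k \<or> s" and y: "y = VC n (t, l)" "odd l \<or> t"
    by auto
  have odd: "int_prod n (VC n (s, k)) (VC n (t, l)) = VC n (s = t, k * l)" if "odd k" "odd l" for s k t l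
    using that by (simp add: VC_def int_prod_Vs)
  have mixed: "int_prod n (VC n (s, k)) (VC n (t, l)) = VC n (True, k * l)" if "odd k \<noteq> odd l" for s k t l
    using that by (auto simp: VC_def int_prod_V_Vs int_prod_Vs_V)
  have even: "int_prod n (VC n (s, k)) (VC n (t, l)) = VC n (True, k * l) + VC n (True, k * l)"
    if "even k" "even l" for s k t l
    using that by (simp add: VC_def int_prod_V_V)
  have *: "VC n (u, k * l) \<in> QV.span (VC n ` ?K)" if "odd (k * l) \<or> u" for u
    using that by (intro QV.span_base imageI) auto
  show "int_prod n x y \<in> QV.span (VC n ` ?K)"
  proof -
    consider "odd k \<noteq> odd l" | "odd k" "odd l" | "even k" "even l" by blast
    then show ?thesis
    proof cases
      case 1
      show ?thesis unfolding x y mixed[OF 1] by (rule *) simp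
    next
      case 2
      show ?thesis unfolding x y odd[OF 2] by (rule *) (simp add: 2)
    next
      case 3
      show ?thesis unfolding x y even[OF 3] by (intro QV.span_add *) simp_all
    qed
  qed
  show "int_prod n x y = int_prod n y x"
  proof -
    consider "odd k \<noteq> odd l" "odd l \<noteq> odd k" | "odd k" "odd l" | "even k" "even l" by blast
    then show ?thesis
    proof cases
      case 1
      show ?thesis unfolding x y mixed[OF 1(1)] mixed[OF 1(2)] by (simp only: mult.commute)
    next
      case 2
      show ?thesis unfolding x y odd[OF 2] odd[OF 2(2,1)] by (simp only: mult.commute eq_commute)
    next
      case 3
      show ?thesis unfolding x y even[OF 3] even[OF 3(2,1)] by (simp only: mult.commute)
    qed
  qed
qed (auto simp: VC_def Vs_in_group_algebra V_in_group_algebra)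

lemma Vs_images:
  "Vs n True ` {1..} = (\<lambda>(s, k). Vs n s k) ` ({True} \<times> {1..})"
  "range (\<lambda>p. Vs n False (2 * p + 2)) = (\<lambda>(s, k). Vs n s k) ` ({False} \<times> {k. even k \<and> 1 \<le> k})"
  "range (\<lambda>p. Vs n True (2 * p + 1)) = (\<lambda>(s, k). Vs n s k) ` ({True} \<times> {k. odd k})"
proof -
  have *: "(\<lambda>(s, k). Vs n s k) ` ({s} \<times> S) = Vs n s ` S" for s S
    by force
  have "{k. even k \<and> 1 \<le> k} = range (\<lambda>p. 2 * p + 2 :: nat)"
  proof (intro equalityI subsetI)
    fix k :: nat assume "k \<in> {k. even k \<and> 1 \<le> k}"
    then obtain m where "k = 2 * m" "1 \<le> m" by auto
    then have "k = 2 * (m - 1) + 2" by simp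
    then show "k \<in> range (\<lambda>p. 2 * p + 2)" by (rule range_eqI)
  qed auto
  then show "range (\<lambda>p. Vs n False (2 * p + 2)) =
      (\<lambda>(s, k). Vs n s k) ` ({False} \<times> {k. even k \<and> 1 \<le> k})"
    by (simp only: * image_image)
  have "{k. odd k} = range (\<lambda>p. 2 * p + 1 :: nat)"
    by (auto elim!: oddE)
  then show "range (\<lambda>p. Vs n True (2 * p + 1)) = (\<lambda>(s, k). Vs n s k) ` ({True} \<times> {k. odd k})"
    by (simp only: * image_image)
  show "Vs n True ` {1..} = (\<lambda>(s, k). Vs n s k) ` ({True} \<times> {1..})"
    by (simp only: *)
qed

theorem theorem4p4:
  fixes n :: nat
  assumes "n \<ge> 2"
  shows
    "QV.span ({Vp k n | k. k \<ge> 1} \<union> {Vm k n | k. k \<ge> 1})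
       = QV.span ({Vp k n | k. 1 \<le> k \<and> k < n} \<union> {Vm k n | k. 1 \<le> k \<and> k < n})
     \<and> QV.span ({Vp k n | k. 1 \<le> k \<and> k < n} \<union> {Vm k n | k. 1 \<le> k \<and> k < n}) = Wpm_space n
     \<and> is_subalgebra n (Wpm_space n)

     \<and> QV.span {V k n | k. k \<ge> 1} = QV.span {V k n | k. 1 \<le> k \<and> k < n}
     \<and> QV.span {V k n | k. 1 \<le> k \<and> k < n} = W_space n
     \<and> comm_subalgebra_of n (W_space n) (Wpm_space n)

     \<and> QV.span {Vp k n | k. k \<ge> 1} = QV.span {Vp k n | k. 1 \<le> k \<and> k \<le> n}
     \<and> QV.span {Vp k n | k. 1 \<le> k \<and> k \<le> n} = W_left_space n
     \<and> comm_subalgebra_of n (W_left_space n) (Wpm_space n)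

     \<and> QV.span {Vm (2 * k) n | k. k \<ge> 1} = QV.span {Vm (2 * k) n | k. 1 \<le> 2 * k \<and> 2 * k \<le> n + 1}
     \<and> QV.span {Vm (2 * k) n | k. 1 \<le> 2 * k \<and> 2 * k \<le> n + 1} = P_space n
     \<and> comm_subalgebra_of n (P_space n) (Wpm_space n)

     \<and> QV.span {Vp (2 * k + 1) n | k. k \<ge> 0}
         = QV.span {Vp (2 * k + 1) n | k. 1 \<le> 2 * k + 1 \<and> 2 * k + 1 \<le> n + 1}
     \<and> QV.span {Vp (2 * k + 1) n | k. 1 \<le> 2 * k + 1 \<and> 2 * k + 1 \<le> n + 1} = P_left_space n
     \<and> comm_subalgebra_of n (P_left_space n) (Wpm_space n)

     \<and> QV.span ({Vp (2 * k + 1) n | k. k \<ge> 0} \<union> {Vm (2 * k + 1) n | k. k \<ge> 0} \<union> {V (2 * k) n | k. k \<ge> 0})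
         = QV.span ({Vp (2 * k + 1) n | k. 1 \<le> 2 * k + 1 \<and> 2 * k + 1 < n}
                     \<union> {Vm (2 * k + 1) n | k. 1 \<le> 2 * k + 1 \<and> 2 * k + 1 < n}
                     \<union> {V (2 * l) n | l. 1 \<le> 2 * l \<and> 2 * l < n})
     \<and> QV.span ({Vp (2 * k + 1) n | k. 1 \<le> 2 * k + 1 \<and> 2 * k + 1 < n}
                     \<union> {Vm (2 * k + 1) n | k. 1 \<le> 2 * k + 1 \<and> 2 * k + 1 < n}
                     \<union> {V (2 * l) n | l. 1 \<le> 2 * l \<and> 2 * l < n}) = C_space n
     \<and> comm_subalgebra_of n (C_space n) (Wpm_space n)

     \<and> (\<forall>x\<in>P_left_space n. \<forall>y\<in>Wpm_space n. int_prod n x y = int_prod n y x)"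
proof -
  note Wpm = span_Wpm[OF assms]
  have U: "QV.span ((\<lambda>(s, k). Vs n s k) ` (UNIV \<times> {1..})) = Wpm_space n"
    using Wpm by (rule trans)
  note W = span_W[OF assms]
  note W_left = span_W_left[OF assms]
  note P = span_P[OF assms]
  note P_left = span_P_left[OF assms]
  note C = span_C[OF assms]
  have odd_pos: "{k. odd k} \<subseteq> {1 :: nat..}"
    by (auto simp: Suc_le_eq odd_pos)
  have "is_subalgebra n (Wpm_space n)"
    using is_subalgebra_Vs[of n] unfolding U .
  moreover have "comm_subalgebra_of n (W_space n) (Wpm_space n)"
    using comm_subalgebra_V[of n] unfolding U W .
  moreover have "comm_subalgebra_of n (W_left_space n) (Wpm_space n)"
  proof -
    have "comm_subalgebra_of n (QV.span ((\<lambda>(s, k). Vs n s k) ` ({True} \<times> {1..})))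
      (QV.span ((\<lambda>(s, k). Vs n s k) ` (UNIV \<times> {1..})))"
      \<comment> \<open>Two positive signs give a positive product, whatever the parities.\<close>
      by (rule comm_subalgebra_subset_Vs) auto
    then show ?thesis unfolding U Vs_images[symmetric] W_left .
  qed
  moreover have "comm_subalgebra_of n (P_space n) (Wpm_space n)"
  proof -
    have "comm_subalgebra_of n (QV.span ((\<lambda>(s, k). Vs n s k) ` ({False} \<times> {k. even k \<and> 1 \<le> k})))
      (QV.span ((\<lambda>(s, k). Vs n s k) ` (UNIV \<times> {1..})))"
      \<comment> \<open>An even left factor passes on its sign, here always negative, and a product
        of even indices is even.\<close>
      by (rule comm_subalgebra_subset_Vs) auto
    then show ?thesis unfolding U Vs_images[symmetric] P .
  qed
  moreover have "comm_subalgebra_of n (P_left_space n) (Wpm_space n)"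
  proof -
    have "comm_subalgebra_of n (QV.span ((\<lambda>(s, k). Vs n s k) ` ({True} \<times> {k. odd k})))
      (QV.span ((\<lambda>(s, k). Vs n s k) ` (UNIV \<times> {1..})))"
      by (rule comm_subalgebra_subset_Vs) (use odd_pos in \<open>auto split: if_splits\<close>)
    then show ?thesis unfolding U Vs_images[symmetric] P_left .
  qed
  moreover have "comm_subalgebra_of n (C_space n) (Wpm_space n)"
    using comm_subalgebra_VC[of n] assms unfolding U C by simp
  \<comment> \<open>A positive sign is neutral: for odd \<open>k\<close> with sign
    \<open>True\<close> both orders of multiplication give the index \<open>k * l\<close> and the
    sign \<open>t\<close> of the other factor.\<close>
  moreover have "int_prod n x y = int_prod n y x" if "x \<in> P_left_space n" "y \<in> Wpm_space n" for x y
  proof (rule int_prod_commute_span)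
    show "x \<in> QV.span (range (\<lambda>p. Vs n True (2 * p + 1)))" using that(1) unfolding P_left .
    show "y \<in> QV.span ((\<lambda>(s, k). Vs n s k) ` (UNIV \<times> {1..}))" using that(2) unfolding U .
    fix x y
    assume "x \<in> range (\<lambda>p. Vs n True (2 * p + 1))" "y \<in> (\<lambda>(s, k). Vs n s k) ` (UNIV \<times> {1..})"
    then obtain p t l where "x = Vs n True (2 * p + 1)" "y = Vs n t l" by auto
    then show "int_prod n x y = int_prod n y x"
      by (simp add: int_prod_Vs mult.commute)
  qed
  ultimately show ?thesis
    unfolding generators_eq(1,2) C_generators_eq unfolding generators_eq(3-6) peak_generators_eq
    using Wpm W W_left P P_left C by (intro conjI ballI) assumption+
qed

end
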